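(* For every $n\in\mathbb N=\{1,2,3,\dots\}$ there is a graph of order $10+24n$ which is a counterexample to each of the following three conjectures. (A) Let $G$ be a cyclically $5$-edge connected cycle permutation graph. If $G$ is a snark, then $G$ must be the Petersen graph. (B) Let $G$ be a cyclically $5$-edge connected cubic graph and $D$ be a set of pairwise disjoint circuits of $G$. Then $D$ is a subset of a CDC of $G$, unless $G$ is the Petersen graph. (C) Let $G$ be a cycle permutation graph with chordless circuits $C_1$ and $C_2$ where $C_1\cup C_2$ is a $2$-factor. If $G$ is cyclically $5$-edge connected and there is no CDC of $G$ which includes both $C_1$ and $C_2$, then $G$ must be the Petersen graph.
   Context: A circuit is a $2$-regular $2$-connected graph. A circuit double cover (CDC) of a cubic graph $G$ is a set $S$ of circuits of $G$ such that every edge of $G$ is covered by exactly two circuits of $S$. A cycle permutation graph is a cubic graph with a $2$-factor consisting of two chordless circuits. A snark is (as usual) a cyclically $4$-edge connected cubic graph of girth at least $5$ that is not $3$-edge colorable. For a graph $G$ containing two vertex-disjoint circuits, $\lambda_c(G)$ is the minimum number of edges one needs to delete in order to obtain two components each containing a circuit; $G$ is cyclically $k$-edge connected if $\lambda_c(G)\ge k$. *)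

theory Defs
  imports Main "HOL-Library.Extended_Nat"
begin

datatype 'a ugraph = Graph (verts: "'a set") (edges: "'a set set")

definition simple_graph :: "'a ugraph \<Rightarrow> bool" where
  "simple_graph G \<longleftrightarrow> finite (verts G) \<and>
     edges G \<subseteq> {{u, v} | u v. u \<in> verts G \<and> v \<in> verts G \<and> u \<noteq> v}"

definition adjacent :: "'a ugraph \<Rightarrow> 'a \<Rightarrow> 'a \<Rightarrow> bool" where
  "adjacent G u v \<longleftrightarrow> {u, v} \<in> edges G"

definition vdegree :: "'a ugraph \<Rightarrow> 'a \<Rightarrow> nat" where
  "vdegree G v = card {e \<in> edges G. v \<in> e}"

definition regular :: "nat \<Rightarrow> 'a ugraph \<Rightarrow> bool" where
  "regular k G \<longleftrightarrow> (\<forall>v \<in> verts G. vdegree G v = k)"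

definition cubic :: "'a ugraph \<Rightarrow> bool" where
  "cubic G \<longleftrightarrow> simple_graph G \<and> regular 3 G"

definition subgraph :: "'a ugraph \<Rightarrow> 'a ugraph \<Rightarrow> bool" where
  "subgraph H G \<longleftrightarrow> simple_graph H \<and> simple_graph G \<and>
     verts H \<subseteq> verts G \<and> edges H \<subseteq> edges G"

definition graph_union :: "'a ugraph \<Rightarrow> 'a ugraph \<Rightarrow> 'a ugraph" where
  "graph_union G H = Graph (verts G \<union> verts H) (edges G \<union> edges H)"

definition del_verts :: "'a ugraph \<Rightarrow> 'a set \<Rightarrow> 'a ugraph" where
  "del_verts G X = Graph (verts G - X) {e \<in> edges G. e \<inter> X = {}}"

definition del_edges :: "'a ugraph \<Rightarrow> 'a set set \<Rightarrow> 'a ugraph" where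
  "del_edges G F = Graph (verts G) (edges G - F)"

definition connected_graph :: "'a ugraph \<Rightarrow> bool" where
  "connected_graph G \<longleftrightarrow> verts G \<noteq> {} \<and>
     (\<forall>u \<in> verts G. \<forall>v \<in> verts G. (adjacent G)\<^sup>*\<^sup>* u v)"

definition vertex_connected :: "nat \<Rightarrow> 'a ugraph \<Rightarrow> bool" where
  "vertex_connected k G \<longleftrightarrow> k < card (verts G) \<and>
     (\<forall>X \<subseteq> verts G. card X < k \<longrightarrow> connected_graph (del_verts G X))"

definition component :: "'a ugraph \<Rightarrow> 'a ugraph \<Rightarrow> bool" where
  "component K G \<longleftrightarrow> subgraph K G \<and> connected_graph K \<and>
     (\<forall>H. subgraph H G \<and> connected_graph H \<and> subgraph K H \<longrightarrow> H = K)"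

definition circuit :: "'a ugraph \<Rightarrow> bool" where
  "circuit C \<longleftrightarrow> simple_graph C \<and> regular 2 C \<and> vertex_connected 2 C"

definition circuit_of :: "'a ugraph \<Rightarrow> 'a ugraph \<Rightarrow> bool" where
  "circuit_of C G \<longleftrightarrow> circuit C \<and> subgraph C G"

definition vertex_disjoint :: "'a ugraph \<Rightarrow> 'a ugraph \<Rightarrow> bool" where
  "vertex_disjoint G H \<longleftrightarrow> verts G \<inter> verts H = {}"

definition chordless :: "'a ugraph \<Rightarrow> 'a ugraph \<Rightarrow> bool" where
  "chordless C G \<longleftrightarrow> (\<forall>e \<in> edges G. e \<subseteq> verts C \<longrightarrow> e \<in> edges C)"

definition two_factor :: "'a ugraph \<Rightarrow> 'a ugraph \<Rightarrow> bool" where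
  "two_factor F G \<longleftrightarrow> subgraph F G \<and> verts F = verts G \<and> regular 2 F"

definition two_factor_of_chordless_circuits ::
  "'a ugraph \<Rightarrow> 'a ugraph \<Rightarrow> 'a ugraph \<Rightarrow> bool" where
  "two_factor_of_chordless_circuits G C1 C2 \<longleftrightarrow>
     circuit_of C1 G \<and> circuit_of C2 G \<and> vertex_disjoint C1 C2 \<and>
     chordless C1 G \<and> chordless C2 G \<and> two_factor (graph_union C1 C2) G"

definition cycle_permutation_graph :: "'a ugraph \<Rightarrow> bool" where
  "cycle_permutation_graph G \<longleftrightarrow> cubic G \<and> (\<exists>C1 C2. two_factor_of_chordless_circuits G C1 C2)"

definition circuit_double_cover :: "'a ugraph set \<Rightarrow> 'a ugraph \<Rightarrow> bool" where
  "circuit_double_cover S G \<longleftrightarrow> (\<forall>C \<in> S. circuit_of C G) \<and>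
     (\<forall>e \<in> edges G. card {C \<in> S. e \<in> edges C} = 2)"

definition cyclic_edge_cut :: "'a ugraph \<Rightarrow> 'a set set \<Rightarrow> bool" where
  "cyclic_edge_cut G F \<longleftrightarrow> F \<subseteq> edges G \<and>
     (\<exists>K1 K2. component K1 (del_edges G F) \<and> component K2 (del_edges G F) \<and> K1 \<noteq> K2 \<and>
        (\<exists>C1. circuit_of C1 K1) \<and> (\<exists>C2. circuit_of C2 K2))"

definition has_two_disjoint_circuits :: "'a ugraph \<Rightarrow> bool" where
  "has_two_disjoint_circuits G \<longleftrightarrow>
     (\<exists>C1 C2. circuit_of C1 G \<and> circuit_of C2 G \<and> vertex_disjoint C1 C2)"

text \<open>Only meaningful for graphs with two vertex-disjoint circuits; otherwise no cyclic edge cut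
  exists and the value is unspecified. For this reason \<open>cyclically_edge_connected\<close> carries
  that condition explicitly.\<close>

definition cyclic_edge_connectivity :: "'a ugraph \<Rightarrow> nat" where
  "cyclic_edge_connectivity G = (LEAST k. \<exists>F. cyclic_edge_cut G F \<and> card F = k)"

definition cyclically_edge_connected :: "nat \<Rightarrow> 'a ugraph \<Rightarrow> bool" where
  "cyclically_edge_connected k G \<longleftrightarrow>
     has_two_disjoint_circuits G \<and> k \<le> cyclic_edge_connectivity G"

definition girth :: "'a ugraph \<Rightarrow> enat" where
  "girth G = (INF C \<in> {C. circuit_of C G}. enat (card (edges C)))"

definition edge_colorable :: "nat \<Rightarrow> 'a ugraph \<Rightarrow> bool" where
  "edge_colorable k G \<longleftrightarrow> (\<exists>c :: 'a set \<Rightarrow> nat.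
     (\<forall>e \<in> edges G. c e < k) \<and>
     (\<forall>e \<in> edges G. \<forall>f \<in> edges G. e \<noteq> f \<and> e \<inter> f \<noteq> {} \<longrightarrow> c e \<noteq> c f))"

definition snark :: "'a ugraph \<Rightarrow> bool" where
  "snark G \<longleftrightarrow> cubic G \<and> cyclically_edge_connected 4 G \<and> 5 \<le> girth G \<and> \<not> edge_colorable 3 G"

definition isomorphic :: "'a ugraph \<Rightarrow> 'b ugraph \<Rightarrow> bool" where
  "isomorphic G H \<longleftrightarrow> (\<exists>f. bij_betw f (verts G) (verts H) \<and>
     (\<forall>u \<in> verts G. \<forall>v \<in> verts G. adjacent G u v \<longleftrightarrow> adjacent H (f u) (f v)))"

text \<open>The Petersen graph as the Kneser graph on the 2-subsets of a 5-set.\<close>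

definition petersen :: "nat set ugraph" where
  "petersen = (let V = {A. A \<subseteq> {..<5} \<and> card A = 2}
     in Graph V {{A, B} | A B. A \<in> V \<and> B \<in> V \<and> A \<inter> B = {}})"

definition is_petersen :: "'a ugraph \<Rightarrow> bool" where
  "is_petersen G \<longleftrightarrow> isomorphic G petersen"

text \<open>Each conjecture quantifies over all graphs; the following predicates express its instance
  at a fixed graph, so that a counterexample is a graph for which the predicate fails.\<close>

definition permutation_snark_conjecture_at :: "'a ugraph \<Rightarrow> bool" where
  "permutation_snark_conjecture_at G \<longleftrightarrow>
     (cyclically_edge_connected 5 G \<and> cycle_permutation_graph G \<longrightarrow>
        (snark G \<longrightarrow> is_petersen G))"

definition disjoint_circuits_conjecture_at :: "'a ugraph \<Rightarrow> bool" where
  "disjoint_circuits_conjecture_at G \<longleftrightarrow>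
     (\<forall>D. cyclically_edge_connected 5 G \<and> cubic G \<and>
        (\<forall>C \<in> D. circuit_of C G) \<and> pairwise vertex_disjoint D \<longrightarrow>
        (\<exists>S. circuit_double_cover S G \<and> D \<subseteq> S) \<or> is_petersen G)"

definition two_factor_conjecture_at :: "'a ugraph \<Rightarrow> bool" where
  "two_factor_conjecture_at G \<longleftrightarrow>
     (\<forall>C1 C2. cycle_permutation_graph G \<and> two_factor_of_chordless_circuits G C1 C2 \<longrightarrow>
        (cyclically_edge_connected 5 G \<and>
         \<not> (\<exists>S. circuit_double_cover S G \<and> C1 \<in> S \<and> C2 \<in> S) \<longrightarrow> is_petersen G))"

end

(* Take the cubic graph on two k-circuits joined by the matching i -- p i, for a permutation p with
   p 0 = 0.  A 3-edge-colouring, or a circuit double cover containing both circuits, labels the circuit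
   edges (by colours, respectively by the second circuit covering the edge) so that at both ends of each
   matching edge the same two distinct labels meet.  Hence both the snark property and the absence of a
   double cover follow as soon as no such labelling exists, and cyclic 5-edge-connectivity amounts to p
   mapping no proper nontrivial interval onto an interval.

   The Petersen graph is the case p = (0,3,1,4,2).  Replacing three consecutive vertices i, p i,
   p i + 1 (a path of length two in the graph: p i is matched to i and adjacent to p i + 1) by a
   suitable pole with 27 vertices adds 24 vertices and preserves both properties, because every
   labelling of the pole induces a labelling of the three vertices it replaces.  The pole again
   contains such a path, so the step can be iterated. *)

theory Submission imports Defs begin

section \<open>Labellings of permutations and the expansion step\<close>

text \<open>Conjectures (B) and (C) fail through a missing double cover, whose labels are circuits
  and so not limited in number. Nonexistence of labellings is therefore proved over an arbitrary
  label type, by equality reasoning; three colours are just one instance. It is transported in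
  contrapositive form: a labelling after expansion contracts to one before. The pole can stand in
  for a path on three vertices because both are attached by five edges: two on each circuit and one
  matching edge. Why intervals: a vertex set consists of positions \<open>A\<close> and
  \<open>B\<close> on the two circuits. A nonempty proper part of a circuit is left by at least two
  circuit edges, and by exactly two only if it is an arc. So if both parts are nonempty and proper,
  at most four boundary edges force two arcs that \<open>p\<close> maps onto each other. Two such
  pairs are harmless: the ends of one matching edge, and the complement of such a pair; hence the
  two exceptions in \<open>interval_simple\<close>. As \<open>p\<close> fixes 0, an arc avoiding 0
  can only be matched to an arc avoiding 0.\<close>

text \<open>\<open>f i\<close> and \<open>g j\<close> label the edges entering position \<open>i\<close> of the first and position \<open>j\<close> of the
  second circuit; the edges leaving them carry \<open>f (Suc i)\<close> and \<open>g (Suc j)\<close>, with index \<open>k\<close>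
  identified with \<open>0\<close>.\<close>

definition labelling :: "nat \<Rightarrow> (nat \<Rightarrow> nat) \<Rightarrow> (nat \<Rightarrow> 'l) \<Rightarrow> (nat \<Rightarrow> 'l) \<Rightarrow> bool" where
  "labelling k p f g \<longleftrightarrow> f 0 = f k \<and> g 0 = g k \<and>
     (\<forall>i<k. f i \<noteq> f (Suc i) \<and> {f i, f (Suc i)} = {g (p i), g (Suc (p i))})"

text \<open>Since \<open>p\<close> will fix \<open>0\<close>, arcs of the circuits that avoid position \<open>0\<close> are the intervals
  considered here; arcs through \<open>0\<close> are covered by passing to complements.\<close>

definition interval_simple :: "nat \<Rightarrow> (nat \<Rightarrow> nat) \<Rightarrow> bool" where
  "interval_simple k p \<longleftrightarrow> (\<forall>u v s t. 1 \<le> u \<and> u \<le> v \<and> v < k \<and> t < k \<and>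
     (\<forall>i<k. i \<in> {u..v} \<longleftrightarrow> p i \<in> {s..t}) \<longrightarrow> u = v \<or> u = 1 \<and> v = k - 1)"

text \<open>The pole (found by computer search) has 13 positions on the first circuit and 14 on the second.
  Position 9 of the latter is left free: it takes over the old partner of \<open>Suc b\<close>.\<close>

definition pole :: "nat \<Rightarrow> nat" where
  "pole i = [6,3,5,11,13,10,1,7,0,2,12,8,4] ! i"

text \<open>The positions \<open>b\<close> and \<open>Suc b\<close> of the second circuit grow to
  \<open>b\<close>, ..., \<open>b + 13\<close>, so later ones move by 12; on the first circuit 13
  positions replace \<open>a\<close>, which is the same shift. The value at \<open>b\<close> is
  junk: \<open>b\<close> is the partner of \<open>a\<close>, which disappears.\<close>

definition shift :: "nat \<Rightarrow> nat \<Rightarrow> nat" where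
  "shift b j = (if j < b then j else if j = Suc b then b + 9 else j + 12)"

definition expand :: "nat \<Rightarrow> nat \<Rightarrow> (nat \<Rightarrow> nat) \<Rightarrow> nat \<Rightarrow> nat" where
  "expand a b p i =
    (if i < a then shift b (p i) else if i \<le> a + 12 then b + pole (i - a) else shift b (p (i - 12)))"

lemma pole_simps:
  "pole 0 = 6" "pole (Suc 0) = 3" "pole 2 = 5" "pole 3 = 11" "pole 4 = 13" "pole 5 = 10" "pole 6 = Suc 0"
  "pole 7 = 7" "pole 8 = 0" "pole 9 = 2" "pole 10 = 12" "pole 11 = 8" "pole 12 = 4"
  by (simp_all add: pole_def)

lemma nat_le_12_iff: "(i::nat) \<le> 12 \<longleftrightarrow> i \<in> {0,Suc 0,2,3,4,5,6,7,8,9,10,11,12}"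
  by (auto simp del: One_nat_def) presburger

lemma pole_inj: "inj_on pole {..12}"
  by (auto simp: inj_on_def nat_le_12_iff pole_simps)

lemma pole_le: "i \<le> 12 \<Longrightarrow> pole i \<le> 13 \<and> pole i \<noteq> 9"
  by (auto simp: nat_le_12_iff pole_simps)

text \<open>What the outside sees of a labelled pole: putting \<open>h\<close> for the element of \<open>{f0, f13}\<close> other than
  \<open>g0\<close>, the labels \<open>g0, h, g14\<close> are admissible around the two vertices \<open>b\<close> and \<open>Suc b\<close> of the
  graph before expansion.\<close>

definition interface_labels :: "'l \<Rightarrow> 'l \<Rightarrow> 'l \<Rightarrow> 'l \<Rightarrow> 'l \<Rightarrow> 'l \<Rightarrow> bool" where
  "interface_labels f0 f13 g0 g9 g10 g14 \<longleftrightarrow> f0 \<noteq> f13 \<and>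
     (f0 = g0 \<and> (g9 = f13 \<and> g10 = g14 \<or> g9 = g14 \<and> g10 = f13) \<or>
      f13 = g0 \<and> (g9 = f0 \<and> g10 = g14 \<or> g9 = g14 \<and> g10 = f0))"

text \<open>Each of the 13 inner spokes leaves two ways to match its labels, and all combinations
  are refuted or lead to the interface by substitution, whatever the number of labels.
  \<open>g9 \<noteq> g10\<close> is all that is needed about the spoke at position 9, whose other
  end lies outside the pole.\<close>

lemma pole_labels:
  assumes "g9 \<noteq> g10"
    "f2 \<noteq> f3" "f2 = g5 \<and> f3 = g6 \<or> f2 = g6 \<and> f3 = g5"
    "f1 \<noteq> f2" "f1 = g3 \<and> f2 = g4 \<or> f1 = g4 \<and> f2 = g3"
    "f0 \<noteq> f1" "f0 = g6 \<and> f1 = g7 \<or> f0 = g7 \<and> f1 = g6"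
    "f3 \<noteq> f4" "f3 = g11 \<and> f4 = g12 \<or> f3 = g12 \<and> f4 = g11"
    "f5 \<noteq> f6" "f5 = g10 \<and> f6 = g11 \<or> f5 = g11 \<and> f6 = g10"
    "f4 \<noteq> f5" "f4 = g13 \<and> f5 = g14 \<or> f4 = g14 \<and> f5 = g13"
    "f8 \<noteq> f9" "f8 = g0 \<and> f9 = g1 \<or> f8 = g1 \<and> f9 = g0"
    "f9 \<noteq> f10" "f9 = g2 \<and> f10 = g3 \<or> f9 = g3 \<and> f10 = g2"
    "f6 \<noteq> f7" "f6 = g1 \<and> f7 = g2 \<or> f6 = g2 \<and> f7 = g1"
    "f10 \<noteq> f11" "f10 = g12 \<and> f11 = g13 \<or> f10 = g13 \<and> f11 = g12"
    "f7 \<noteq> f8" "f7 = g7 \<and> f8 = g8 \<or> f7 = g8 \<and> f8 = g7"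
    "f11 \<noteq> f12" "f11 = g8 \<and> f12 = g9 \<or> f11 = g9 \<and> f12 = g8"
    "f12 \<noteq> f13" "f12 = g4 \<and> f13 = g5 \<or> f12 = g5 \<and> f13 = g4"
  shows "interface_labels f0 f13 g0 g9 g10 g14"
  using assms by auto (auto simp: interface_labels_def)

text \<open>The Petersen graph fails for labels of every kind: this gives both that it has no
  3-edge-colouring and that no double cover contains the two pentagons.\<close>

lemma petersen_labels_contradiction:
  assumes "f0 \<noteq> f1" "{f0, f1} = {g0, g1}"
    "f1 \<noteq> f2" "{f1, f2} = {g3, g4}"
    "f2 \<noteq> f3" "{f2, f3} = {g1, g2}"
    "f3 \<noteq> f4" "{f3, f4} = {g4, g0}"
    "f4 \<noteq> f0" "{f4, f0} = {g2, g3}"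
  shows False
  using assms unfolding doubleton_eq_iff by auto

lemma pole_surj:
  assumes "j \<le> 13" "j \<noteq> 9"
  shows "\<exists>i\<le>12. pole i = j"
proof -
  have "j \<in> pole ` {..12}"
  proof (rule subsetD)
    have "pole ` {..12} = {..13} - {9}"
    proof (rule card_subset_eq)
      show "pole ` {..12} \<subseteq> {..13} - {9}"
        using pole_le by auto
      show "card (pole ` {..12}) = card ({..13} - {9::nat})"
        using pole_inj by (simp add: card_image)
    qed simp
    then show "{..13} - {9} \<subseteq> pole ` {..12}" by simp
    show "j \<in> {..13} - {9}" using assms by simp
  qed
  then show ?thesis by auto
qed

text \<open>An interval containing two consecutive positions of the pole has an image whose hull meets
  further positions; iterating, it swallows the whole pole.\<close>

lemma pole_intervals:
  fixes u v s t a b :: nat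
  assumes P: "\<And>i. i \<le> 12 \<Longrightarrow> (u \<le> a+i \<and> a+i \<le> v) = (s \<le> b+pole i \<and> b+pole i \<le> t)"
    and uv: "u \<le> v" and st: "s \<le> t"
  shows "s = t \<or> u = v \<or> (u \<le> a \<and> a+12 \<le> v \<and> s \<le> b \<and> b+13 \<le> t) \<or>
    ((v < a \<or> a+12 < u) \<and> (t < b \<or> b+13 < s))"
proof -
  define I J where "I i \<longleftrightarrow> u \<le> a+i \<and> a+i \<le> v" and "J j \<longleftrightarrow> s \<le> b+j \<and> b+j \<le> t" for i j
  have E: "I 0 = J 6"
    "I 1 = J 3" "I 2 = J 5" "I 3 = J 11" "I 4 = J 13"
    "I 5 = J 10" "I 6 = J 1" "I 7 = J 7" "I 8 = J 0" "I 9 = J 2" "I 10 = J 12"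
    "I 11 = J 8" "I 12 = J 4"
    using P[of 0] P[of "Suc 0"] P[of 2] P[of 3] P[of 4] P[of 5] P[of 6] P[of 7] P[of 8] P[of 9]
      P[of 10] P[of 11] P[of 12]
    by (simp_all add: pole_simps I_def J_def)
  have J_between: "J z" if "J x" "J y" "x \<le> z" "z \<le> y" for x y z
    using that by (auto simp: J_def)
  have I_between: "I z" if "I x" "I y" "x \<le> z" "z \<le> y" for x y z
    using that by (auto simp: I_def)
  \<comment> \<open>The target is always the positions 0 and 12, matched to 6 and 4: by convexity
    everything between them follows, in particular positions 8 and 4, whose partners 0 and 13 are
    the extremes of the other side.\<close>
  have pair0: "I 0 \<and> I 12" if "I 0" "I 1"
  proof -
    have "J 3" "J 6" using that E by simp_all
    then have "J 6" "J 4" using J_between[of 3 6] by simp_all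
    then have "I 0" "I 12" using E by simp_all
    then show ?thesis by simp
  qed
  have pair1: "I 0 \<and> I 12" if "I 1" "I 2"
  proof -
    have "J 3" "J 5" using that E by simp_all
    then have "J 3" "J 4" using J_between[of 3 5] by simp_all
    then have "I 1" "I 12" using E by simp_all
    then have "I 8" "I 4" using I_between[of 1 12] by simp_all
    then have "J 0" "J 13" using E by simp_all
    then have "J 6" "J 4" using J_between[of 0 13] by simp_all
    then have "I 0" "I 12" using E by simp_all
    then show ?thesis by simp
  qed
  have pair2: "I 0 \<and> I 12" if "I 2" "I 3"
  proof -
    have "J 5" "J 11" using that E by simp_all
    then have "J 6" "J 8" using J_between[of 5 11] by simp_all
    then have "I 0" "I 11" using E by simp_all
    then have "I 8" "I 4" using I_between[of 0 11] by simp_all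
    then have "J 0" "J 13" using E by simp_all
    then have "J 6" "J 4" using J_between[of 0 13] by simp_all
    then have "I 0" "I 12" using E by simp_all
    then show ?thesis by simp
  qed
  have pair3: "I 0 \<and> I 12" if "I 3" "I 4"
  proof -
    have "J 11" "J 13" using that E by simp_all
    then have "J 11" "J 12" using J_between[of 11 13] by simp_all
    then have "I 3" "I 10" using E by simp_all
    then have "I 8" "I 4" using I_between[of 3 10] by simp_all
    then have "J 0" "J 13" using E by simp_all
    then have "J 6" "J 4" using J_between[of 0 13] by simp_all
    then have "I 0" "I 12" using E by simp_all
    then show ?thesis by simp
  qed
  have pair4: "I 0 \<and> I 12" if "I 4" "I 5"
  proof -
    have "J 10" "J 13" using that E by simp_all
    then have "J 11" "J 12" using J_between[of 10 13] by simp_all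
    then have "I 3" "I 10" using E by simp_all
    then have "I 8" "I 4" using I_between[of 3 10] by simp_all
    then have "J 0" "J 13" using E by simp_all
    then have "J 6" "J 4" using J_between[of 0 13] by simp_all
    then have "I 0" "I 12" using E by simp_all
    then show ?thesis by simp
  qed
  have pair5: "I 0 \<and> I 12" if "I 5" "I 6"
  proof -
    have "J 1" "J 10" using that E by simp_all
    then have "J 6" "J 4" using J_between[of 1 10] by simp_all
    then have "I 0" "I 12" using E by simp_all
    then show ?thesis by simp
  qed
  have pair6: "I 0 \<and> I 12" if "I 6" "I 7"
  proof -
    have "J 1" "J 7" using that E by simp_all
    then have "J 6" "J 4" using J_between[of 1 7] by simp_all
    then have "I 0" "I 12" using E by simp_all
    then show ?thesis by simp
  qed
  have pair7: "I 0 \<and> I 12" if "I 7" "I 8"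
  proof -
    have "J 0" "J 7" using that E by simp_all
    then have "J 6" "J 4" using J_between[of 0 7] by simp_all
    then have "I 0" "I 12" using E by simp_all
    then show ?thesis by simp
  qed
  have pair8: "I 0 \<and> I 12" if "I 8" "I 9"
  proof -
    have "J 0" "J 2" using that E by simp_all
    then have "J 1" "J 2" using J_between[of 0 2] by simp_all
    then have "I 6" "I 9" using E by simp_all
    then have "I 8" "I 7" using I_between[of 6 9] by simp_all
    then have "J 0" "J 7" using E by simp_all
    then have "J 6" "J 4" using J_between[of 0 7] by simp_all
    then have "I 0" "I 12" using E by simp_all
    then show ?thesis by simp
  qed
  have pair9: "I 0 \<and> I 12" if "I 9" "I 10"
  proof -
    have "J 2" "J 12" using that E by simp_all
    then have "J 6" "J 4" using J_between[of 2 12] by simp_all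
    then have "I 0" "I 12" using E by simp_all
    then show ?thesis by simp
  qed
  have pair10: "I 0 \<and> I 12" if "I 10" "I 11"
  proof -
    have "J 8" "J 12" using that E by simp_all
    then have "J 11" "J 8" using J_between[of 8 12] by simp_all
    then have "I 3" "I 11" using E by simp_all
    then have "I 8" "I 4" using I_between[of 3 11] by simp_all
    then have "J 0" "J 13" using E by simp_all
    then have "J 6" "J 4" using J_between[of 0 13] by simp_all
    then have "I 0" "I 12" using E by simp_all
    then show ?thesis by simp
  qed
  have pair11: "I 0 \<and> I 12" if "I 11" "I 12"
  proof -
    have "J 4" "J 8" using that E by simp_all
    then have "J 6" "J 4" using J_between[of 4 8] by simp_all
    then have "I 0" "I 12" using E by simp_all
    then show ?thesis by simp
  qed
  have full: ?thesis if "I 0 \<and> I 12"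
  proof -
    have "I 8" "I 4" using that I_between[of 0 12] by simp_all
    then have "J 0" "J 13" using E by simp_all
    then show ?thesis using that by (auto simp: I_def J_def)
  qed
  have empty: ?thesis if "v < a \<or> a + 12 < u"
  proof (rule ccontr)
    assume neg: "\<not> ?thesis"
    \<comment> \<open>With the first interval off the pole, \<open>{s..t}\<close> can meet the
      pole's range only in the free position 9; as \<open>s \<noteq> t\<close> and nothing in that
      range precedes it, position 10 would be met too.\<close>
    have noJ: "\<not> J j" if "j \<le> 13" "j \<noteq> 9" for j
    proof -
      obtain i where "i \<le> 12" "pole i = j" using pole_surj \<open>j \<le> 13\<close> \<open>j \<noteq> 9\<close> by blast
      then show ?thesis
        using P[of i] \<open>v < a \<or> a + 12 < u\<close> by (auto simp: J_def)
    qed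
    have "b \<le> t" "s \<le> b + 13" "s \<noteq> t" using neg that by auto
    moreover have "b \<le> s"
      using noJ[of 0] \<open>b \<le> t\<close> by (auto simp: J_def)
    moreover from this have "J (s - b)"
      using st by (simp add: J_def)
    ultimately have "s - b = 9"
      using noJ[of "s - b"] by linarith
    then show False
      using noJ[of 10] st \<open>s \<noteq> t\<close> by (simp add: J_def) linarith
  qed
  show ?thesis
  proof (cases "u = v \<or> u \<le> a \<or> a + 12 \<le> u")
    case True
    then consider "u = v" | "v < a \<or> a + 12 < u" | "u \<le> a" "v = a" | "u \<le> a" "a + 1 \<le> v" | "u = a + 12"
      by linarith
    then show ?thesis
    proof cases
      \<comment> \<open>Only pole position 0 is inside, so the image contains 6 but neither 5 nor 7
        and is a single point. At the other end of the pole, 4 lies between 3 and 5 in the same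
        way.\<close>
      assume "u \<le> a" "v = a"
      then have "J 6" "\<not> J 5" "\<not> J 7"
        using E by (auto simp: I_def simp flip: E)
      then show ?thesis by (auto simp: J_def)
    next
      assume "u \<le> a" "a + 1 \<le> v"
      then show ?thesis
        using pair0 full by (auto simp: I_def)
    next
      assume "u = a + 12"
      then have "J 4" "\<not> J 3" "\<not> J 5"
        using uv by (auto simp: I_def simp flip: E)
      then show ?thesis by (auto simp: J_def)
    qed (use empty in auto)
  next
    case False
    define d where "d = u - a"
    have d: "u = a + d" "d \<le> 12" "d \<noteq> 0" "d \<noteq> 12" "a + d + 1 \<le> v"
      using False uv by (auto simp: d_def)
    have "I d" "I (Suc d)"
      using d by (auto simp: I_def)
    moreover have "d = 1 \<or> d = 2 \<or> d = 3 \<or> d = 4 \<or> d = 5 \<or>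
        d = 6 \<or> d = 7 \<or> d = 8 \<or> d = 9 \<or> d = 10 \<or> d = 11"
      using d(2-4) by (auto simp: nat_le_12_iff)
    ultimately have "I 0 \<and> I 12"
      using pair1 pair2 pair3 pair4 pair5 pair6 pair7 pair8 pair9 pair10 pair11
      by (elim disjE) (simp_all add: numeral_2_eq_2[symmetric])
    then show ?thesis by (rule full)
  qed
qed

section \<open>Expansion of a permutation: bijectivity, labellings and intervals\<close>

lemma expand_pole: "i \<le> 12 \<Longrightarrow> expand a b p (a + i) = b + pole i"
  by (simp add: expand_def)

lemma expand_shift: "i \<noteq> a \<Longrightarrow> expand a b p (if i < a then i else i + 12) = shift b (p i)"
  by (simp add: expand_def)

lemma shift_inj: "\<lbrakk>shift b x = shift b y; x \<noteq> b; y \<noteq> b\<rbrakk> \<Longrightarrow> x = y"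
  by (auto simp: shift_def split: if_splits)

lemma shift_pole: "\<lbrakk>i \<le> 12; x \<noteq> b\<rbrakk> \<Longrightarrow> shift b x \<noteq> b + pole i"
  using pole_le[of i] by (auto simp: shift_def)

lemma position_cases:
  fixes i a k :: nat
  assumes "i < k + 12" "a < k"
  obtains (pole) i' where "i' \<le> 12" "i = a + i'"
  | (old) i' where "i' < k" "i' \<noteq> a" "i = (if i' < a then i' else i' + 12)"
proof (cases "i < a \<or> a + 12 < i")
  case True
  then show ?thesis
    using assms by (intro old[of "if i < a then i else i - 12"]) auto
next
  case False
  then show ?thesis
    by (intro pole[of "i - a"]) auto
qed

lemma expand_bij:
  assumes p: "bij_betw p {..<k} {..<k}" and a: "a < k" "p a = b" and b: "Suc b < k"
  shows "bij_betw (expand a b p) {..<k+12} {..<k+12}"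
proof -
  have inj: "inj_on p {..<k}" and img: "\<And>i. i < k \<Longrightarrow> p i < k"
    using p by (auto simp: bij_betw_def)
  have ne: "p i \<noteq> b" if "i < k" "i \<noteq> a" for i
    using inj that a by (auto simp: inj_on_def)
  have "inj_on (expand a b p) {..<k+12}"
  proof (rule inj_onI)
    fix x y assume xy: "x \<in> {..<k+12}" "y \<in> {..<k+12}" and eq: "expand a b p x = expand a b p y"
    have x: "x < k + 12" and y: "y < k + 12" using xy by auto
    show "x = y"
      using x \<open>a < k\<close>
    proof (cases rule: position_cases)
      case x: (pole i)
      show ?thesis
        using y \<open>a < k\<close>
      proof (cases rule: position_cases)
        case y: (pole j)
        have "pole i = pole j"
          using eq x y by (simp add: expand_pole)
        then show ?thesis
          using x y pole_inj by (auto simp: inj_on_def)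
      next
        case y: (old j)
        have "b + pole i = shift b (p j)"
          using eq x(1) unfolding x(2) y(3) by (simp only: expand_pole expand_shift[OF y(2)])
        with shift_pole[OF x(1) ne[OF y(1,2)]] show ?thesis by simp
      qed
    next
      case x: (old i)
      show ?thesis
        using y \<open>a < k\<close>
      proof (cases rule: position_cases)
        case y: (pole j)
        have "b + pole j = shift b (p i)"
          using eq y(1) unfolding y(2) x(3) by (simp only: expand_pole expand_shift[OF x(2)])
        with shift_pole[OF y(1) ne[OF x(1,2)]] show ?thesis by simp
      next
        case y: (old j)
        have "shift b (p i) = shift b (p j)"
          using eq unfolding x(3) y(3) by (simp only: expand_shift[OF x(2)] expand_shift[OF y(2)])
        then have "p i = p j"
          using shift_inj ne x y by blast
        then show ?thesis
          using x y inj by (auto simp: inj_on_def)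
      qed
    qed
  qed
  moreover have "expand a b p ` {..<k+12} \<subseteq> {..<k+12}"
  proof (rule image_subsetI)
    fix x assume "x \<in> {..<k+12}"
    then have "x < k + 12" by simp
    then show "expand a b p x \<in> {..<k+12}"
      using \<open>a < k\<close>
    proof (cases rule: position_cases)
      case (pole i)
      then show ?thesis
        using pole_le[of i] b by (simp add: expand_pole)
    next
      case (old i)
      then show ?thesis
        using img[of i] b unfolding old(3) expand_shift[OF old(2)] by (auto simp: shift_def)
    qed
  qed
  ultimately show ?thesis
    by (simp add: bij_betw_def endo_inj_surj)
qed

text \<open>The pole is contracted: edges outside keep their labels, and \<open>pole_labels\<close>
  supplies a label for the one edge that contraction brings back, from \<open>b\<close> to
  \<open>Suc b\<close>.\<close>

lemma labelling_expand:
  fixes f g :: "nat \<Rightarrow> 'l"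
  assumes p: "bij_betw p {..<k} {..<k}" and a: "a < k" "p a = b" and b: "Suc b < k"
    and L: "labelling (k + 12) (expand a b p) f g"
  shows "\<exists>f' g' :: nat \<Rightarrow> 'l. labelling k p f' g'"
proof -
  have "Suc b \<in> p ` {..<k}"
    using p b by (simp add: bij_betw_def)
  then obtain c where c: "c < k" "p c = Suc b" by auto
  have ne: "p i \<noteq> b" if "i < k" "i \<noteq> a" for i
    using p that a by (auto simp: bij_betw_def inj_on_def)
  have ca: "c \<noteq> a" using c a by auto
  have end_eq: "f 0 = f (k + 12)" "g 0 = g (k + 12)"
    using L by (auto simp: labelling_def)
  define F G where "F i = f (a + i)" and "G j = g (b + j)" for i j
  have pl: "F i \<noteq> F (Suc i) \<and> {F i, F (Suc i)} = {G (pole i), G (Suc (pole i))}"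
    if "i \<le> 12" for i
    using L a(1) that expand_pole[of i a b p] by (auto simp: labelling_def F_def G_def)
  have old: "f i' \<noteq> f (Suc i') \<and> {f i', f (Suc i')} = {g (shift b (p i)), g (Suc (shift b (p i)))}"
    if "i < k" "i \<noteq> a" "i' = (if i < a then i else i + 12)" for i i'
    using L that expand_shift[of i a b p] by (auto simp: labelling_def split: if_splits)
  define c' where "c' = (if c < a then c else c + 12)"
  have shc: "shift b (Suc b) = b + 9" by (simp add: shift_def)
  have cl: "f c' \<noteq> f (Suc c')" "{f c', f (Suc c')} = {g (b + 9), g (b + 10)}"
    using old[OF c(1) ca c'_def] unfolding c(2) shc by (simp_all add: numeral_eq_Suc)
  \<comment> \<open>The spoke at \<open>b + 9\<close> ends in \<open>c'\<close> outside the pole,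
    where two distinct labels meet; equal labels here would make that pair a singleton.\<close>
  then have "g (b + 9) \<noteq> g (b + 10)" by (metis doubleton_eq_iff insert_absorb2)
  then have "G 9 \<noteq> G 10" by (simp add: G_def)
  have ne_F: "F i \<noteq> F j" if "i \<le> 12" "j = Suc i" for i j
    using pl[OF that(1)] that(2) by simp
  have FG: "F i = G x \<and> F j = G y \<or> F i = G y \<and> F j = G x"
    if "pole i = x" "i \<le> 12" "j = Suc i" "y = Suc x" for i j x y
    using pl[OF that(2)] unfolding that(1,3,4) doubleton_eq_iff by simp
  have "interface_labels (F 0) (F 13) (G 0) (G 9) (G 10) (G 14)"
    by (rule pole_labels[OF \<open>G 9 \<noteq> G 10\<close>
        ne_F[of 2 3] FG[OF pole_simps(3), of 3 6]
        ne_F[of "Suc 0" 2] FG[OF pole_simps(2), of 2 4]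
        ne_F[of 0 "Suc 0"] FG[OF pole_simps(1), of "Suc 0" 7]
        ne_F[of 3 4] FG[OF pole_simps(4), of 4 12]
        ne_F[of 5 6] FG[OF pole_simps(6), of 6 11]
        ne_F[of 4 5] FG[OF pole_simps(5), of 5 14]
        ne_F[of 8 9] FG[OF pole_simps(9), of 9 "Suc 0"]
        ne_F[of 9 10] FG[OF pole_simps(10), of 10 3]
        ne_F[of 6 7] FG[OF pole_simps(7), of 7 2]
        ne_F[of 10 11] FG[OF pole_simps(11), of 11 13]
        ne_F[of 7 8] FG[OF pole_simps(8), of 8 8]
        ne_F[of 11 12] FG[OF pole_simps(12), of 12 9]
        ne_F[of 12 13] FG[OF pole_simps(13), of 13 5]])
      simp_all
  then have "interface_labels (f a) (f (a + 13)) (g b) (g (b + 9)) (g (b + 10)) (g (b + 14))"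
    by (simp add: F_def G_def)
  moreover define h where "h = (if f a = g b then f (a + 13) else f a)"
  ultimately have h: "f a \<noteq> f (a + 13)" "{f a, f (a + 13)} = {g b, h}"
      "{g (b + 9), g (b + 10)} = {h, g (b + 14)}"
    unfolding interface_labels_def by auto
  \<comment> \<open>The threshold is \<open>i \<le> a\<close>, not \<open>i < a\<close>: labels sit
    on entering edges, so the edge entering \<open>a\<close> stays, and the one leaving
    \<open>a\<close> is the old edge entering \<open>a + 13\<close>. Likewise \<open>g'\<close>
    jumps from \<open>b\<close> to \<open>b + 14\<close>, with \<open>h\<close> in between.\<close>
  define f' where "f' i = f (if i \<le> a then i else i + 12)" for i
  define g' where "g' j = (if j = Suc b then h else g (if j \<le> b then j else j + 12))" for j
  have "f' i \<noteq> f' (Suc i) \<and> {f' i, f' (Suc i)} = {g' (p i), g' (Suc (p i))}" if "i < k" for i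
  proof (cases "i = a")
    case True
    then show ?thesis
      using h a by (simp add: f'_def g'_def add.commute)
  next
    case False
    define i' where "i' = (if i < a then i else i + 12)"
    have "f' i = f i'" "f' (Suc i) = f (Suc i')"
      using False by (auto simp: f'_def i'_def)
    moreover have "{g (shift b (p i)), g (Suc (shift b (p i)))} = {g' (p i), g' (Suc (p i))}"
    proof (cases "p i = Suc b")
      case True
      then show ?thesis
        using h(3) by (simp add: shc g'_def add.commute)
    next
      case False
      then show ?thesis
        using ne[OF that \<open>i \<noteq> a\<close>] by (auto simp: shift_def g'_def)
    qed
    ultimately show ?thesis
      using old[OF that False i'_def] by simp
  qed
  moreover have "f' 0 = f' k" "g' 0 = g' k"
    using a b end_eq by (auto simp: f'_def g'_def)
  ultimately have "labelling k p f' g'"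
    by (simp add: labelling_def)
  then show ?thesis by blast
qed

lemma shift_mem_full:
  assumes "s \<le> b" "b + 13 \<le> t" "j \<noteq> b"
  shows "s \<le> shift b j \<and> shift b j \<le> t \<longleftrightarrow> s \<le> j \<and> j \<le> t - 12"
  using assms by (auto simp: shift_def)

lemma shift_mem_avoid:
  assumes "t < b \<or> b + 13 < s" "j \<noteq> b"
  shows "s \<le> shift b j \<and> shift b j \<le> t \<longleftrightarrow>
    (if t < b then s else s - 12) \<le> j \<and> j \<le> (if t < b then t else t - 12)"
  using assms by (auto simp: shift_def)

lemma position_mem_full:
  assumes "u \<le> a" "a + 12 \<le> v" "i \<noteq> a" "i' = (if i < a then i else i + 12)"
  shows "u \<le> i' \<and> i' \<le> v \<longleftrightarrow> u \<le> i \<and> i \<le> v - (12::nat)"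
  using assms by auto

lemma position_mem_avoid:
  assumes "v < a \<or> a + 12 < u" "u \<le> v" "i \<noteq> a" "i' = (if i < a then i else i + 12)"
  shows "u \<le> i' \<and> i' \<le> v \<longleftrightarrow>
    (if v < a then u else u - 12) \<le> i \<and> i \<le> (if v < a then v else v - (12::nat))"
  using assms by auto

text \<open>By \<open>pole_intervals\<close>, a matched pair of intervals with more than one point
  each either swallows the pole on both circuits or avoids it on both. Contracting the pole then
  turns it into a matched pair for \<open>p\<close>.\<close>

lemma interval_simple_expand:
  assumes p: "bij_betw p {..<k} {..<k}" and a: "1 \<le> a" "a < k" "p a = b" and b: "Suc b < k"
    and S: "interval_simple k p"
  shows "interval_simple (k + 12) (expand a b p)"
  unfolding interval_simple_def
proof (intro allI impI, elim conjE)
  fix u v s t :: nat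
  assume u: "1 \<le> u" and uv: "u \<le> v" and v: "v < k + 12" and t: "t < k + 12"
    and H: "\<forall>i<k + 12. (i \<in> {u..v}) = (expand a b p i \<in> {s..t})"
  have "Suc b \<in> p ` {..<k}"
    using p b by (simp add: bij_betw_def)
  then obtain c where c: "c < k" "p c = Suc b" by auto
  have ne: "p i \<noteq> b" if "i < k" "i \<noteq> a" for i
    using p that a by (auto simp: bij_betw_def inj_on_def)
  have st: "expand a b p u \<in> {s..t}" "expand a b p v \<in> {s..t}"
    using H u uv v by (meson atLeastAtMost_iff le_refl le_less_trans)+
  have pole: "(u \<le> a + i \<and> a + i \<le> v) = (s \<le> b + pole i \<and> b + pole i \<le> t)" if "i \<le> 12" for i
    using H[rule_format, of "a + i"] that a by (simp add: expand_pole)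
  have old: "(u \<le> i' \<and> i' \<le> v) = (s \<le> shift b (p i) \<and> shift b (p i) \<le> t)"
    if "i < k" "i \<noteq> a" "i' = (if i < a then i else i + 12)" for i i'
    using H[rule_format, of i'] that expand_shift[of i a b p] by (auto split: if_splits)
  consider "s = t" | "u = v" | (full) "u \<le> a" "a + 12 \<le> v" "s \<le> b" "b + 13 \<le> t"
    | (avoid) "v < a \<or> a + 12 < u" "t < b \<or> b + 13 < s"
    using pole_intervals[OF pole uv] st(1) by fastforce
  then show "u = v \<or> u = 1 \<and> v = k + 12 - 1"
  proof cases
    assume "s = t"
    then have "expand a b p u = expand a b p v"
      using st by auto
    then show ?thesis
      using expand_bij[OF p a(2,3) b] uv v by (auto simp: bij_betw_def inj_on_def)
  next
    assume "u = v"
    then show ?thesis ..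
  next
    case full
    have in_iff: "i \<in> {u..v - 12} \<longleftrightarrow> p i \<in> {s..t - 12}" if "i < k" for i
    proof (cases "i = a")
      case False
      then show ?thesis
        using old[OF that False refl] shift_mem_full[OF full(3,4) ne[OF that False]]
          position_mem_full[OF full(1,2) False refl] by simp
    qed (use full a in auto)
    have "u = v - 12 \<or> u = 1 \<and> v - 12 = k - 1"
    proof -
      have "u \<le> v - 12" "v - 12 < k" "t - 12 < k"
        using full v t a(2) by linarith+
      then show ?thesis
        using S[unfolded interval_simple_def, rule_format, of u "v - 12" "t - 12" s] in_iff u by blast
    qed
    \<comment> \<open>The contracted image contains both \<open>b\<close> and \<open>Suc b\<close>,
      so the contracted interval contains both \<open>a\<close> and \<open>c\<close>.\<close>
    moreover have "u \<noteq> v - 12"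
    proof
      assume "u = v - 12"
      moreover have "c \<in> {u..v - 12}" "a \<in> {u..v - 12}"
        using in_iff[OF c(1)] c(2) full by auto
      ultimately show False using c a by auto
    qed
    ultimately show ?thesis using full by auto
  next
    case avoid
    define u' v' where "u' = (if v < a then u else u - 12)" and "v' = (if v < a then v else v - 12)"
    define s' t' where "s' = (if t < b then s else s - 12)" and "t' = (if t < b then t else t - 12)"
    have in_iff: "i \<in> {u'..v'} \<longleftrightarrow> p i \<in> {s'..t'}" if "i < k" for i
    proof (cases "i = a")
      case False
      then show ?thesis
        using old[OF that False refl] shift_mem_avoid[OF avoid(2) ne[OF that False]]
          position_mem_avoid[OF avoid(1) uv False refl]
        unfolding atLeastAtMost_iff u'_def v'_def s'_def t'_def by simp
    qed (use avoid a uv in \<open>auto simp: u'_def v'_def s'_def t'_def\<close>)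
    have "1 \<le> u'" "u' \<le> v'" "v' < k" "t' < k"
      using u uv v t avoid a b by (auto simp: u'_def v'_def t'_def)
    then have "u' = v' \<or> u' = 1 \<and> v' = k - 1"
      using S[unfolded interval_simple_def, rule_format, of u' v' t' s'] in_iff by auto
    \<comment> \<open>This excludes the alternative \<open>{1..k - 1}\<close>, which would contain
      \<open>a\<close>.\<close>
    moreover have "\<not> (u' \<le> a \<and> a \<le> v')"
      using avoid uv by (auto simp: u'_def v'_def)
    ultimately show ?thesis
      using a uv avoid by (auto simp: u'_def v'_def split: if_splits)
  qed
qed

section \<open>The Petersen permutation and its iterated expansion\<close>

definition petersen_perm :: "nat \<Rightarrow> nat" where
  "petersen_perm i = [0,3,1,4,2] ! i"

lemma petersen_perm_simps:
  "petersen_perm 0 = 0" "petersen_perm (Suc 0) = 3" "petersen_perm 2 = 1" "petersen_perm 3 = 4"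
  "petersen_perm 4 = 2"
  by (simp_all add: petersen_perm_def)

lemma nat_less_5_iff: "(i::nat) < 5 \<longleftrightarrow> i \<in> {0,Suc 0,2,3,4}"
  by (auto simp del: One_nat_def)

lemma petersen_perm_bij: "bij_betw petersen_perm {..<5} {..<5}"
proof -
  have "inj_on petersen_perm {..<5}" "petersen_perm ` {..<5} \<subseteq> {..<5}"
    by (auto simp: inj_on_def nat_less_5_iff petersen_perm_simps)
  then show ?thesis by (simp add: bij_betw_def endo_inj_surj)
qed

lemma petersen_no_labelling: "\<not> labelling 5 petersen_perm f g"
proof
  assume "labelling 5 petersen_perm f g"
  then have ends: "f 5 = f 0" "g 5 = g 0"
    and L: "\<And>i. i < 5 \<Longrightarrow> f i \<noteq> f (Suc i) \<and> {f i, f (Suc i)} = {g (petersen_perm i), g (Suc (petersen_perm i))}"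
    by (auto simp: labelling_def)
  show False
    apply (rule petersen_labels_contradiction[where ?f0.0 = "f 0" and ?f1.0 = "f 1" and ?f2.0 = "f 2" and ?f3.0 = "f 3"
      and ?f4.0 = "f 4" and ?g0.0 = "g 0" and ?g1.0 = "g 1" and ?g2.0 = "g 2" and ?g3.0 = "g 3"
      and ?g4.0 = "g 4"])
    using L[of 0] L[of "Suc 0"] L[of 2] L[of 3] L[of 4]
    by (simp_all add: petersen_perm_simps ends numeral_2_eq_2[symmetric])
qed

lemma petersen_interval_simple: "interval_simple 5 petersen_perm"
  unfolding interval_simple_def
proof (intro allI impI, elim conjE)
  fix u v s t :: nat
  assume *: "1 \<le> u" "u \<le> v" "v < 5" "t < 5"
    and H: "\<forall>i<5. (i \<in> {u..v}) = (petersen_perm i \<in> {s..t})"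
  show "u = v \<or> u = 1 \<and> v = 5 - 1"
    using * H[rule_format, of 0] H[rule_format, of "Suc 0"] H[rule_format, of 2] H[rule_format, of 3]
      H[rule_format, of 4]
    unfolding petersen_perm_simps atLeastAtMost_iff by presburger
qed

text \<open>\<open>pole 1 = 3\<close> and \<open>pole 12 = 4\<close>, so position \<open>Suc a\<close> is matched to \<open>b + 3\<close> after expansion at
  \<open>(a, b)\<close>; this is where the next expansion takes place.\<close>

fun snark_perm :: "nat \<Rightarrow> nat \<Rightarrow> nat" where
  "snark_perm 0 = petersen_perm"
| "snark_perm (Suc n) = expand (4 + n) (2 + 3 * n) (snark_perm n)"

lemma snark_perm_props:
  "bij_betw (snark_perm n) {..<5 + 12 * n} {..<5 + 12 * n}"
  "snark_perm n 0 = 0" "snark_perm n (4 + n) = 2 + 3 * n"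
  "interval_simple (5 + 12 * n) (snark_perm n)"
  "\<not> labelling (5 + 12 * n) (snark_perm n) f g"
proof -
  \<comment> \<open>The labellings are quantified inside the induction, since contracting the pole
    changes them.\<close>
  have "bij_betw (snark_perm n) {..<5 + 12 * n} {..<5 + 12 * n} \<and> snark_perm n 0 = 0 \<and>
    snark_perm n (4 + n) = 2 + 3 * n \<and> interval_simple (5 + 12 * n) (snark_perm n) \<and>
    (\<nexists>f g. labelling (5 + 12 * n) (snark_perm n) (f :: nat \<Rightarrow> 'a) g)"
  proof (induction n)
    case 0
    then show ?case
      by (simp add: petersen_perm_bij petersen_no_labelling petersen_interval_simple petersen_perm_simps)
  next
    case (Suc n)
    have k: "5 + 12 * Suc n = 5 + 12 * n + 12" by simp
    have e: "expand (4 + n) (2 + 3 * n) (snark_perm n) (4 + n + Suc 0) = 2 + 3 * n + pole (Suc 0)"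
      by (rule expand_pole) simp
    \<comment> \<open>Position 0 lies before the pole on both circuits.\<close>
    have "expand (4 + n) (2 + 3 * n) (snark_perm n) 0 = 0"
      using Suc by (simp add: expand_def shift_def)
    then show ?case
      unfolding k snark_perm.simps
      using Suc e expand_bij[of "snark_perm n" "5 + 12 * n" "4 + n" "2 + 3 * n"]
        labelling_expand[of "snark_perm n" "5 + 12 * n" "4 + n" "2 + 3 * n"]
        interval_simple_expand[of "snark_perm n" "5 + 12 * n" "4 + n" "2 + 3 * n"]
      by (auto simp: pole_simps)
  qed
  then show "bij_betw (snark_perm n) {..<5 + 12 * n} {..<5 + 12 * n}"
    "snark_perm n 0 = 0" "snark_perm n (4 + n) = 2 + 3 * n"
    "interval_simple (5 + 12 * n) (snark_perm n)"
    "\<not> labelling (5 + 12 * n) (snark_perm n) f g"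
    by blast+
qed

section \<open>Edge cuts of permutation graphs\<close>

definition next_pos :: "nat \<Rightarrow> nat \<Rightarrow> nat" where
  "next_pos k i = (if Suc i = k then 0 else Suc i)"

text \<open>An index \<open>i\<close> stands for the circuit edge from \<open>i\<close> to
  \<open>next_pos k i\<close>.\<close>

definition boundary :: "nat \<Rightarrow> nat set \<Rightarrow> nat set" where
  "boundary k A = {i. i < k \<and> (i \<in> A) \<noteq> (next_pos k i \<in> A)}"

lemma next_pos_less: "i < k \<Longrightarrow> next_pos k i < k"
  by (auto simp: next_pos_def)

lemma finite_boundary [simp]: "finite (boundary k A)"
  by (simp add: boundary_def)

lemma boundary_Compl: "boundary k ({..<k} - A) = boundary k A"
  using next_pos_less by (auto simp: boundary_def)

text \<open>As 0 is not in \<open>A\<close>, no run of \<open>A\<close> wraps around: the edge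
  entering the minimum and the edge leaving the maximum are two different boundary edges.\<close>

lemma boundary_ends:
  assumes "A \<subseteq> {..<k}" "0 \<notin> A" "A \<noteq> {}"
  shows "Min A - 1 \<in> boundary k A" "Max A \<in> boundary k A" "Min A - 1 \<noteq> Max A" "1 \<le> Min A"
    "Min A \<le> Max A" "Max A < k"
proof -
  have fin: "finite A" using assms(1) finite_subset by blast
  have mi: "Min A \<in> A" and ma: "Max A \<in> A" using fin assms by auto
  show le: "Min A \<le> Max A" using fin assms(3) ma by simp
  show pos: "1 \<le> Min A" using mi assms(2) by (cases "Min A = 0") auto
  show lt: "Max A < k" using ma assms(1) by auto
  have "Min A - 1 \<notin> A" using Min_le[OF fin, of "Min A - 1"] pos by auto
  then show "Min A - 1 \<in> boundary k A"
    using mi pos le lt by (auto simp: boundary_def next_pos_def)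
  have "Suc (Max A) \<notin> A" using Max_ge[OF fin, of "Suc (Max A)"] by auto
  then show "Max A \<in> boundary k A"
    using ma assms(2) lt by (auto simp: boundary_def next_pos_def)
  show "Min A - 1 \<noteq> Max A" using pos le by auto
qed

lemma boundary_card_ge2:
  assumes "A \<subseteq> {..<k}" "0 \<notin> A" "A \<noteq> {}"
  shows "2 \<le> card (boundary k A)"
proof -
  have "card {Min A - 1, Max A} \<le> card (boundary k A)"
    by (rule card_mono) (use boundary_ends[OF assms] in auto)
  then show ?thesis using boundary_ends(3)[OF assms] by simp
qed

lemma boundary_card_ge2':
  assumes "A \<subseteq> {..<k}" "A \<noteq> {}" "A \<noteq> {..<k}"
  shows "2 \<le> card (boundary k A)"
proof (cases "0 \<in> A")
  case True
  then show ?thesis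
    using boundary_card_ge2[of "{..<k} - A" k] assms by (auto simp: boundary_Compl)
qed (use boundary_card_ge2 assms in auto)

text \<open>A gap \<open>w\<close> would yield a third boundary edge, the one leaving the last
  element of \<open>A\<close> before \<open>w\<close>.\<close>

lemma interval_if_boundary_le2:
  assumes "A \<subseteq> {..<k}" "0 \<notin> A" "A \<noteq> {}" and two: "card (boundary k A) \<le> 2"
  shows "A = {Min A..Max A}"
proof (rule ccontr)
  have fin: "finite A" using assms(1) finite_subset by blast
  assume "A \<noteq> {Min A..Max A}"
  then obtain w where w: "Min A \<le> w" "w \<le> Max A" "w \<notin> A"
  proof -
    have "A \<subseteq> {Min A..Max A}" using fin by auto
    then obtain w where "w \<in> {Min A..Max A}" "w \<notin> A"
      using \<open>A \<noteq> {Min A..Max A}\<close> by blast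
    then show ?thesis using that[of w] by simp
  qed
  note e = boundary_ends[OF assms(1-3)]
  define i where "i = Max (A \<inter> {..<w})"
  have "Min A \<noteq> w" using w(3) Min_in[OF fin assms(3)] by blast
  then have ne: "A \<inter> {..<w} \<noteq> {}"
    using w Min_in[OF fin assms(3)] by auto
  then have i: "i \<in> A" "i < w"
    using Max_in[of "A \<inter> {..<w}"] fin by (auto simp: i_def)
  have "Suc i \<notin> A"
  proof
    assume "Suc i \<in> A"
    moreover from this have "Suc i \<noteq> w" using w(3) by blast
    ultimately have "Suc i \<in> A \<inter> {..<w}" using i(2) by simp
    then have "Suc i \<le> i" unfolding i_def using fin by (intro Max_ge) simp_all
    then show False by simp
  qed
  then have ib: "i \<in> boundary k A"
    using i w e by (auto simp: boundary_def next_pos_def)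
  have "Min A \<le> i" using i fin by simp
  then have "card {Min A - 1, i, Max A} = 3"
    using i w e by auto
  moreover have "card {Min A - 1, i, Max A} \<le> card (boundary k A)"
    by (rule card_mono) (use ib e in auto)
  ultimately show False using two by simp
qed

text \<open>Apart from the mismatched spokes, \<open>p\<close> matches \<open>A\<close> with
  \<open>B\<close>. This forces many spokes across a cut whose one side is empty or full.\<close>

lemma mismatch_card:
  fixes k :: nat
  assumes p: "bij_betw p {..<k} {..<k}" and AB: "A \<subseteq> {..<k}" "B \<subseteq> {..<k}"
  shows "card A \<le> card B + card {i. i < k \<and> (i \<in> A) \<noteq> (p i \<in> B)}"
    and "card B \<le> card A + card {i. i < k \<and> (i \<in> A) \<noteq> (p i \<in> B)}"
proof -
  define M where "M = {i. i < k \<and> (i \<in> A) \<noteq> (p i \<in> B)}"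
  define B' where "B' = {i. i < k \<and> p i \<in> B}"
  have fin: "finite M" "finite B'" "finite A"
  proof -
    have "M \<subseteq> {..<k}" "B' \<subseteq> {..<k}" by (auto simp: M_def B'_def)
    then show "finite M" "finite B'" "finite A"
      using AB(1) by (simp_all add: finite_subset[OF _ finite_lessThan[of k]])
  qed
  have "B \<subseteq> p ` {..<k}"
    using p AB(2) by (simp add: bij_betw_def)
  then have im: "p ` B' = B"
    by (auto simp: B'_def)
  have "inj_on p B'"
    using p by (auto simp: B'_def bij_betw_def inj_on_def)
  then have c: "card B' = card B"
    using card_image[of p B'] im by simp
  have "A \<subseteq> B' \<union> M" "B' \<subseteq> A \<union> M"
    using AB by (auto simp: B'_def M_def)
  then have "card A \<le> card (B' \<union> M)" "card B' \<le> card (A \<union> M)"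
    using fin by (auto intro: card_mono)
  then show "card A \<le> card B + card M" "card B \<le> card A + card M"
    using c card_Un_le[of B' M] card_Un_le[of A M] by simp_all
qed

text \<open>If a part is empty or full, the size bounds force three mismatched spokes besides two
  circuit edges, or at least \<open>k\<close> mismatches. Otherwise each circuit contributes two
  edges, so fewer than five in all means two intervals matched without mismatch; by
  \<open>interval_simple\<close> these have 1 or \<open>k - 1\<close> elements each, which the size
  bounds exclude.\<close>

lemma permutation_cut_ge5:
  assumes p: "bij_betw p {..<k} {..<k}" "p 0 = 0" and simple: "interval_simple k p" and k: "5 \<le> k"
    and AB: "A \<subseteq> {..<k}" "B \<subseteq> {..<k}" and lo: "3 \<le> card A + card B" and hi: "card A + card B + 3 \<le> 2 * k"
  shows "5 \<le> card (boundary k A) + card (boundary k B) + card {i. i < k \<and> (i \<in> A) \<noteq> (p i \<in> B)}"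
proof -
  have main: "5 \<le> card (boundary k A) + card (boundary k B) + card {i. i < k \<and> (i \<in> A) \<noteq> (p i \<in> B)}"
    if AB: "A \<subseteq> {..<k}" "B \<subseteq> {..<k}" and lo: "3 \<le> card A + card B" and hi: "card A + card B + 3 \<le> 2 * k"
      and z: "0 \<notin> A" for A B
  proof -
    note m = mismatch_card[OF p(1) AB]
    have A2: "A = {} \<or> 2 \<le> card (boundary k A)" using boundary_card_ge2[OF AB(1) z] by blast
    have B2: "B = {} \<or> B = {..<k} \<or> 2 \<le> card (boundary k B)" using boundary_card_ge2'[OF AB(2)] by blast
    show ?thesis
    proof (cases "A = {} \<or> B = {} \<or> B = {..<k}")
      case True
      then show ?thesis using A2 B2 m lo hi k by auto
    next
      case False
      then have ge2: "2 \<le> card (boundary k A)" "2 \<le> card (boundary k B)" using A2 B2 by auto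
      show ?thesis
      proof (rule ccontr)
        assume "\<not> ?thesis"
        then have le2: "card (boundary k A) \<le> 2" "card (boundary k B) \<le> 2"
          and m0: "card {i. i < k \<and> (i \<in> A) \<noteq> (p i \<in> B)} = 0"
          using ge2 by linarith+
        have iff: "i \<in> A \<longleftrightarrow> p i \<in> B" if "i < k" for i
          using m0 that by simp
        have "0 \<notin> B" using iff[of 0] p(2) z k by auto
        have IA: "A = {Min A..Max A}" using interval_if_boundary_le2[OF AB(1) z] False le2 by blast
        have IB: "B = {Min B..Max B}" using interval_if_boundary_le2[OF AB(2) \<open>0 \<notin> B\<close>] False le2 by blast
        have eA: "1 \<le> Min A" "Min A \<le> Max A" "Max A < k"
          using boundary_ends(4-6)[OF AB(1) z] False by blast+
        have "Max B < k" using boundary_ends(6)[OF AB(2) \<open>0 \<notin> B\<close>] False by blast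
        then have "Min A = Max A \<or> Min A = 1 \<and> Max A = k - 1"
          using simple[unfolded interval_simple_def, rule_format, of "Min A" "Max A" "Max B" "Min B"]
            eA iff unfolding IA[symmetric] IB[symmetric] by blast
        moreover have "card A = Suc (Max A) - Min A"
          by (subst IA) simp
        ultimately have "card A = 1 \<or> card A = k - 1" using eA by auto
        moreover have "card A = card B" using m unfolding m0 by linarith
        ultimately show False using lo hi k by auto
      qed
    qed
  qed
  show ?thesis
  proof (cases "0 \<in> A")
    case False
    then show ?thesis by (rule main[OF AB lo hi])
  next
    \<comment> \<open>Complementing both parts preserves boundaries and mismatches and exchanges the
      two size bounds.\<close>
    case True
    have c: "card ({..<k} - A) = k - card A" "card ({..<k} - B) = k - card B" "card A \<le> k" "card B \<le> k"
      using AB finite_subset[OF AB(1)] finite_subset[OF AB(2)] card_mono[OF _ AB(1)] card_mono[OF _ AB(2)]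
      by (simp_all add: card_Diff_subset)
    have eq: "{i. i < k \<and> (i \<in> {..<k} - A) \<noteq> (p i \<in> {..<k} - B)} = {i. i < k \<and> (i \<in> A) \<noteq> (p i \<in> B)}"
      using p(1) by (auto simp: bij_betw_def)
    have "0 \<notin> {..<k} - A" using True by simp
    moreover have "3 \<le> card ({..<k} - A) + card ({..<k} - B)"
      "card ({..<k} - A) + card ({..<k} - B) + 3 \<le> 2 * k"
      using c lo hi by linarith+
    ultimately show ?thesis
      using main[of "{..<k} - A" "{..<k} - B"] unfolding boundary_Compl eq by simp
  qed
qed

section \<open>Connectivity and circuits\<close>

lemma simple_graph_edgeE:
  assumes "simple_graph G" "e \<in> edges G"
  obtains u v where "e = {u, v}" "u \<in> verts G" "v \<in> verts G" "u \<noteq> v"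
  using assms unfolding simple_graph_def by blast

lemma simple_graph_edge_subset: "simple_graph G \<Longrightarrow> e \<in> edges G \<Longrightarrow> e \<subseteq> verts G"
  by (erule (1) simple_graph_edgeE) simp

lemma finite_edges: "simple_graph G \<Longrightarrow> finite (edges G)"
  by (rule finite_subset[of _ "Pow (verts G)"]) (auto simp: simple_graph_def)

lemma adjacent_sym: "adjacent G u v \<Longrightarrow> adjacent G v u"
  by (simp add: adjacent_def insert_commute)

lemma reachable_sym: "(adjacent G)\<^sup>*\<^sup>* u v \<Longrightarrow> (adjacent G)\<^sup>*\<^sup>* v u"
  by (induction rule: rtranclp_induct) (auto intro: adjacent_sym converse_rtranclp_into_rtranclp)

lemma reachable_mono:
  "edges H \<subseteq> edges G \<Longrightarrow> (adjacent H)\<^sup>*\<^sup>* u v \<Longrightarrow> (adjacent G)\<^sup>*\<^sup>* u v"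
  by (erule rtranclp_mono[THEN predicate2D, rotated]) (auto simp: adjacent_def)

lemma connected_graphI:
  assumes "r \<in> verts G" "\<And>v. v \<in> verts G \<Longrightarrow> (adjacent G)\<^sup>*\<^sup>* r v"
  shows "connected_graph G"
  unfolding connected_graph_def
proof (intro conjI ballI)
  show "verts G \<noteq> {}" using assms(1) by auto
  fix u v assume "u \<in> verts G" "v \<in> verts G"
  then show "(adjacent G)\<^sup>*\<^sup>* u v"
    by (rule rtranclp_trans[OF reachable_sym[OF assms(2)] assms(2)])
qed

lemma connected_graph_union:
  assumes "connected_graph G" "connected_graph H" "x \<in> verts G" "x \<in> verts H"
  shows "connected_graph (graph_union G H)"
proof (rule connected_graphI)
  show "x \<in> verts (graph_union G H)" using assms by (simp add: graph_union_def)
  fix v assume "v \<in> verts (graph_union G H)"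
  then have "(adjacent G)\<^sup>*\<^sup>* x v \<or> (adjacent H)\<^sup>*\<^sup>* x v"
    using assms by (auto simp: graph_union_def connected_graph_def)
  then show "(adjacent (graph_union G H))\<^sup>*\<^sup>* x v"
    by (auto intro: reachable_mono[rotated] simp: graph_union_def)
qed

lemma simple_graph_union: "simple_graph G \<Longrightarrow> simple_graph H \<Longrightarrow> simple_graph (graph_union G H)"
  unfolding simple_graph_def graph_union_def by (simp, blast)

lemma componentD: "component K G \<Longrightarrow> subgraph K G" "component K G \<Longrightarrow> connected_graph K"
  by (simp_all add: component_def)

text \<open>The union of \<open>K\<close> with \<open>H\<close> is again connected, so maximality
  makes it equal to \<open>K\<close>.\<close>

lemma component_absorbs:
  assumes K: "component K G" and H: "subgraph H G" "connected_graph H"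
    and x: "x \<in> verts K" "x \<in> verts H"
  shows "verts H \<subseteq> verts K" "edges H \<subseteq> edges K"
proof -
  have "subgraph (graph_union K H) G" "subgraph K (graph_union K H)"
    using componentD(1)[OF K] H(1) simple_graph_union[of K H]
    by (simp_all add: subgraph_def) (auto simp: graph_union_def)
  moreover have "connected_graph (graph_union K H)"
    by (rule connected_graph_union[OF componentD(2)[OF K] H(2) x])
  ultimately have "graph_union K H = K"
    using K unfolding component_def by blast
  then have "verts (graph_union K H) = verts K" "edges (graph_union K H) = edges K"
    by simp_all
  then show "verts H \<subseteq> verts K" "edges H \<subseteq> edges K"
    by (auto simp: graph_union_def)
qed

lemma components_disjoint:
  assumes "component K G" "component L G" "K \<noteq> L"
  shows "verts K \<inter> verts L = {}"
proof (rule ccontr)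
  assume "verts K \<inter> verts L \<noteq> {}"
  then obtain x where x: "x \<in> verts K" "x \<in> verts L" by blast
  have "verts K = verts L" "edges K = edges L"
    using component_absorbs[OF assms(1) componentD[OF assms(2)] x]
      component_absorbs[OF assms(2) componentD[OF assms(1)] x(2,1)] by auto
  then show False using assms(3) by (simp add: ugraph.expand)
qed

section \<open>Edge boundaries, cyclic edge cuts and girth\<close>

definition edge_boundary :: "'a ugraph \<Rightarrow> 'a set \<Rightarrow> 'a set set" where
  "edge_boundary G S = {e \<in> edges G. e \<inter> S \<noteq> {} \<and> \<not> e \<subseteq> S}"

text \<open>A surviving edge that leaves \<open>K\<close> would be a connected subgraph meeting
  \<open>K\<close>, hence absorbed by it.\<close>

lemma edge_boundary_component:
  assumes K: "component K (del_edges G F)"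
  shows "edge_boundary G (verts K) \<subseteq> F"
proof
  fix e assume e: "e \<in> edge_boundary G (verts K)"
  show "e \<in> F"
  proof (rule ccontr)
    assume "e \<notin> F"
    then have eG: "e \<in> edges (del_edges G F)" using e by (simp add: edge_boundary_def del_edges_def)
    have simple: "simple_graph (del_edges G F)" using componentD(1)[OF K] by (simp add: subgraph_def)
    from simple_graph_edgeE[OF simple eG] obtain a b where ab: "e = {a, b}"
      "a \<in> verts (del_edges G F)" "b \<in> verts (del_edges G F)" "a \<noteq> b" by metis
    obtain x where x: "x \<in> e" "x \<in> verts K" using e by (auto simp: edge_boundary_def)
    let ?H = "Graph {a, b} {e}"
    have "subgraph ?H (del_edges G F)"
      using ab eG simple by (auto simp: subgraph_def simple_graph_def)
    moreover have "connected_graph ?H"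
      by (rule connected_graphI[of a]) (auto simp: adjacent_def ab)
    ultimately have "e \<subseteq> verts K"
      using component_absorbs(1)[OF K, of ?H x] x ab by auto
    then show False using e by (simp add: edge_boundary_def)
  qed
qed

lemma componentI:
  assumes C: "subgraph C G" "connected_graph C"
    and closed: "\<And>e. e \<in> edges G \<Longrightarrow> e \<inter> verts C \<noteq> {} \<Longrightarrow> e \<in> edges C"
  shows "component C G"
  unfolding component_def
proof (intro conjI allI impI)
  fix H assume H: "subgraph H G \<and> connected_graph H \<and> subgraph C H"
  obtain r where r: "r \<in> verts C" using C(2) by (auto simp: connected_graph_def)
  have simple: "simple_graph C" "simple_graph H" using H by (auto simp: subgraph_def)
  have "verts H \<subseteq> verts C"
  proof
    fix v assume "v \<in> verts H"
    then have "(adjacent H)\<^sup>*\<^sup>* r v"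
      using H r by (auto simp: connected_graph_def subgraph_def)
    then show "v \<in> verts C"
    proof (induction rule: rtranclp_induct)
      case (step y z)
      then have "{y, z} \<in> edges C"
        using H by (intro closed) (auto simp: adjacent_def subgraph_def)
      then show ?case
        using simple_graph_edge_subset[OF simple(1), of "{y, z}"] by simp
    qed (rule r)
  qed
  then have V: "verts H = verts C" using H by (auto simp: subgraph_def)
  have "edges H \<subseteq> edges C"
  proof
    fix e assume e: "e \<in> edges H"
    from simple_graph_edgeE[OF simple(2) e] obtain u v where "e = {u, v}" "u \<in> verts H"
      by metis
    then have "e \<inter> verts C \<noteq> {}"
      using V by auto
    moreover have "e \<in> edges G" using e H by (auto simp: subgraph_def)
    ultimately show "e \<in> edges C" by (intro closed)
  qed
  then have "edges H = edges C" using H by (auto simp: subgraph_def)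
  with V show "H = C" by (simp add: ugraph.expand)
qed (fact C)+

lemma circuit_card_verts: "circuit C \<Longrightarrow> 3 \<le> card (verts C)"
  by (simp add: circuit_def vertex_connected_def)

lemma handshake:
  assumes "simple_graph G" "regular d G"
  shows "d * card (verts G) = 2 * card (edges G)"
proof -
  have "card {v \<in> verts G. v \<in> e} = 2" if "e \<in> edges G" for e
  proof -
    obtain a b where "e = {a, b}" "a \<in> verts G" "b \<in> verts G" "a \<noteq> b"
      using simple_graph_edgeE[OF assms(1) \<open>e \<in> edges G\<close>] by metis
    then have "{v \<in> verts G. v \<in> e} = {a, b}" by auto
    then show ?thesis using \<open>a \<noteq> b\<close> by simp
  qed
  then have "(\<Sum>v\<in>verts G. card {e \<in> edges G. v \<in> e}) = 2 * card (edges G)"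
    using assms(1) finite_edges by (intro sum_multicount) (auto simp: simple_graph_def)
  then show ?thesis
    using assms(2) by (simp add: regular_def vdegree_def mult.commute)
qed

lemma circuit_degree:
  assumes "circuit_of C G"
  shows "{e \<in> edges C. v \<in> e} = {} \<or> card {e \<in> edges C. v \<in> e} = 2"
proof (cases "v \<in> verts C")
  case True
  then show ?thesis using assms by (auto simp: circuit_of_def circuit_def regular_def vdegree_def)
next
  case False
  then have "{e \<in> edges C. v \<in> e} = {}"
    using assms simple_graph_edge_subset[of C] by (auto simp: circuit_of_def circuit_def)
  then show ?thesis ..
qed

text \<open>Sides with at most two vertices contain no circuit, so this bounds every cyclic edge cut; it also
  bounds the girth, as a circuit of length \<open>l\<close> in a cubic graph has at most \<open>l\<close> boundary edges.\<close>

definition essentially_5_edge_connected :: "'a ugraph \<Rightarrow> bool" where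
  "essentially_5_edge_connected G \<longleftrightarrow> (\<forall>S \<subseteq> verts G. 3 \<le> card S \<and> 3 \<le> card (verts G - S) \<longrightarrow>
     5 \<le> card (edge_boundary G S))"

text \<open>One component serves as the vertex set \<open>S\<close>; the other lies in its
  complement, and both have three vertices because they contain circuits.\<close>

lemma cyclic_edge_cut_ge5:
  assumes "simple_graph G" "essentially_5_edge_connected G" "cyclic_edge_cut G F"
  shows "5 \<le> card F"
proof -
  obtain K L where KL: "component K (del_edges G F)" "component L (del_edges G F)" "K \<noteq> L"
    and circ: "\<exists>C. circuit_of C K" "\<exists>C. circuit_of C L" and F: "F \<subseteq> edges G"
    using assms(3) by (auto simp: cyclic_edge_cut_def)
  have sub: "verts K \<subseteq> verts G" "verts L \<subseteq> verts G"
    using componentD(1)[OF KL(1)] componentD(1)[OF KL(2)] by (auto simp: subgraph_def del_edges_def)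
  have fin: "finite (verts G)" using assms(1) by (simp add: simple_graph_def)
  have big: "3 \<le> card (verts H)" if "\<exists>C. circuit_of C H" "verts H \<subseteq> verts G" for H :: "'a ugraph"
    using that circuit_card_verts card_mono finite_subset[OF that(2) fin]
    unfolding circuit_of_def subgraph_def by (meson order_trans)
  have "verts L \<subseteq> verts G - verts K"
    using components_disjoint[OF KL] sub by auto
  then have "3 \<le> card (verts G - verts K)"
    using big[OF circ(2) sub(2)] card_mono[of "verts G - verts K" "verts L"] fin by auto
  then have "5 \<le> card (edge_boundary G (verts K))"
    using assms(2) big[OF circ(1) sub(1)] sub(1) by (auto simp: essentially_5_edge_connected_def)
  also have "\<dots> \<le> card F"
    using edge_boundary_component[OF KL(1)] finite_subset[OF F finite_edges[OF assms(1)]] by (rule card_mono[rotated])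
  finally show ?thesis .
qed

text \<open>A circuit with at most 4 of at least 7 vertices leaves 3 outside, so its boundary has 5
  edges; but each of its vertices has only one edge off the circuit.\<close>

lemma girth_ge5:
  assumes G: "cubic G" "essentially_5_edge_connected G" "7 \<le> card (verts G)"
  shows "5 \<le> girth G"
  unfolding girth_def
proof (rule INF_greatest)
  fix C assume "C \<in> {C. circuit_of C G}"
  then have C: "circuit_of C G" by simp
  have simple: "simple_graph C" "regular 2 C" and sub: "verts C \<subseteq> verts G" "edges C \<subseteq> edges G"
    using C by (auto simp: circuit_of_def circuit_def subgraph_def)
  have fin: "finite (verts G)" "finite (edges G)"
    using G(1) finite_edges[of G] by (simp_all add: cubic_def simple_graph_def)
  have finC: "finite (verts C)" by (rule finite_subset[OF sub(1) fin(1)])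
  have eq: "card (edges C) = card (verts C)"
    using handshake[OF simple] by simp
  have "5 \<le> card (verts C)"
  proof (rule ccontr)
    assume small: "\<not> 5 \<le> card (verts C)"
    have "card (edge_boundary G (verts C)) \<le> (\<Sum>v\<in>verts C. 1)"
    proof -
      have "edge_boundary G (verts C) \<subseteq> (\<Union>v\<in>verts C. {e \<in> edges G. v \<in> e} - {e \<in> edges C. v \<in> e})"
      proof
        fix e assume e: "e \<in> edge_boundary G (verts C)"
        then have "e \<notin> edges C"
          using simple_graph_edge_subset[OF simple(1), of e] by (auto simp: edge_boundary_def)
        then show "e \<in> (\<Union>v\<in>verts C. {e \<in> edges G. v \<in> e} - {e \<in> edges C. v \<in> e})"
          using e by (auto simp: edge_boundary_def)
      qed
      then have "card (edge_boundary G (verts C)) \<le>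
          card (\<Union>v\<in>verts C. {e \<in> edges G. v \<in> e} - {e \<in> edges C. v \<in> e})"
        using fin finC by (intro card_mono) auto
      also have "\<dots> \<le> (\<Sum>v\<in>verts C. card ({e \<in> edges G. v \<in> e} - {e \<in> edges C. v \<in> e}))"
        by (rule card_UN_le) (fact finC)
      also have "\<dots> = (\<Sum>v\<in>verts C. 1)"
      proof (rule sum.cong)
        fix v assume v: "v \<in> verts C"
        have "card ({e \<in> edges G. v \<in> e} - {e \<in> edges C. v \<in> e}) = vdegree G v - vdegree C v"
          using sub(2) finite_subset[OF sub(2) fin(2)] unfolding vdegree_def by (intro card_Diff_subset) auto
        then show "card ({e \<in> edges G. v \<in> e} - {e \<in> edges C. v \<in> e}) = 1"
          using v subsetD[OF sub(1) v] G(1) simple(2) by (simp add: cubic_def regular_def)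
      qed simp
      finally show ?thesis .
    qed
    moreover have "3 \<le> card (verts C)"
      using C circuit_card_verts[of C] by (simp add: circuit_of_def)
    moreover have "3 \<le> card (verts G - verts C)"
      using sub(1) finC small G(3) by (simp add: card_Diff_subset)
    ultimately show False
      using G(2)[unfolded essentially_5_edge_connected_def, rule_format, OF sub(1)] small by simp
  qed
  then show "5 \<le> enat (card (edges C))"
    by (simp add: eq numeral_eq_enat)
qed

lemma petersen_card_verts: "is_petersen G \<Longrightarrow> card (verts G) = 10"
proof -
  assume "is_petersen G"
  then have "card (verts G) = card (verts petersen)"
    by (auto simp: is_petersen_def isomorphic_def bij_betw_same_card)
  also have "\<dots> = card {A. A \<subseteq> {..<5::nat} \<and> card A = 2}"
    by (simp add: petersen_def Let_def)
  also have "\<dots> = 5 choose 2"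
    by (subst n_subsets) simp_all
  finally show ?thesis by (simp add: choose_two)
qed

text \<open>Junk unless \<open>S\<close> is a double cover containing \<open>C\<close> and \<open>e\<close> is an edge of \<open>C\<close>.\<close>

definition other_circuit :: "'a ugraph set \<Rightarrow> 'a ugraph \<Rightarrow> 'a set \<Rightarrow> 'a ugraph" where
  "other_circuit S C e = (THE D. D \<in> S \<and> D \<noteq> C \<and> e \<in> edges D)"

lemma other_circuit:
  assumes S: "circuit_double_cover S G" "C \<in> S" and e: "e \<in> edges C" "e \<in> edges G"
  shows "{D \<in> S. e \<in> edges D} = {C, other_circuit S C e}" "other_circuit S C e \<noteq> C"
proof -
  have "card {D \<in> S. e \<in> edges D} = 2"
    using S e by (auto simp: circuit_double_cover_def)
  then obtain X Y where XY: "{D \<in> S. e \<in> edges D} = {X, Y}" "X \<noteq> Y"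
    unfolding card_2_iff by metis
  have "C \<in> {X, Y}" unfolding XY(1)[symmetric] using S e by simp
  then obtain D where D: "{D \<in> S. e \<in> edges D} = {C, D}" "D \<noteq> C"
    using XY by (metis insertE insert_commute singletonD)
  have iff: "(D' \<in> S \<and> D' \<noteq> C \<and> e \<in> edges D') = (D' = D)" for D'
  proof -
    have "D' \<in> S \<and> e \<in> edges D' \<longleftrightarrow> D' \<in> {C, D}" unfolding D(1)[symmetric] by simp
    then show ?thesis using D(2) by auto
  qed
  have "other_circuit S C e = D"
    unfolding other_circuit_def iff by simp
  with D show "{D \<in> S. e \<in> edges D} = {C, other_circuit S C e}" "other_circuit S C e \<noteq> C"
    by simp_all
qed

lemma not_subset_singletonE:
  assumes "\<not> A \<subseteq> {x}"
  obtains z where "z \<in> A" "z \<noteq> x"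
  using assms by blast

text \<open>A circuit of \<open>S\<close> through \<open>m\<close> has degree 2 at \<open>v\<close>,
  so it goes on along \<open>x\<close> or \<open>y\<close>; not being \<open>C\<close>, it is the
  second circuit there. Since two circuits pass through \<open>m\<close>, the two second circuits
  differ and are exactly these.\<close>

lemma double_cover_at_vertex:
  assumes S: "circuit_double_cover S G" "C \<in> S"
    and v: "{e \<in> edges G. v \<in> e} = {x, y, m}" "x \<noteq> y"
    and C: "x \<in> edges C" "y \<in> edges C" "m \<notin> edges C"
  shows "other_circuit S C x \<noteq> other_circuit S C y \<and>
    {other_circuit S C x, other_circuit S C y} = {D \<in> S. m \<in> edges D}"
proof -
  have "x \<in> {e \<in> edges G. v \<in> e}" "y \<in> {e \<in> edges G. v \<in> e}" "m \<in> {e \<in> edges G. v \<in> e}"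
    unfolding v(1) by simp_all
  then have inG: "x \<in> edges G" "y \<in> edges G" "m \<in> edges G" and vm: "v \<in> m" by simp_all
  have two: "card {D \<in> S. m \<in> edges D} = 2"
    using S inG by (auto simp: circuit_double_cover_def)
  have sub: "{D \<in> S. m \<in> edges D} \<subseteq> {other_circuit S C x, other_circuit S C y}"
  proof
    fix D assume D: "D \<in> {D \<in> S. m \<in> edges D}"
    then have circ: "circuit_of D G" using S by (auto simp: circuit_double_cover_def)
    have at: "{e \<in> edges D. v \<in> e} \<subseteq> {x, y, m}"
      unfolding v(1)[symmetric] using circ by (auto simp: circuit_of_def subgraph_def)
    have m: "m \<in> {e \<in> edges D. v \<in> e}" using D vm by simp
    then have "{e \<in> edges D. v \<in> e} \<noteq> {}" by (metis empty_iff)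
    with circuit_degree[OF circ, of v] have deg: "card {e \<in> edges D. v \<in> e} = 2" by argo
    have "\<not> {e \<in> edges D. v \<in> e} \<subseteq> {m}"
    proof
      assume "{e \<in> edges D. v \<in> e} \<subseteq> {m}"
      then have "card {e \<in> edges D. v \<in> e} \<le> card {m}" by (rule card_mono[rotated]) simp
      with deg show False by simp
    qed
    then obtain z where "z \<in> {e \<in> edges D. v \<in> e}" "z \<noteq> m" by (rule not_subset_singletonE)
    then have "x \<in> edges D \<or> y \<in> edges D" using subsetD[OF at, of z] by auto
    moreover have "D \<noteq> C" using D C(3) by (metis mem_Collect_eq)
    moreover have "D \<in> {C, other_circuit S C x}" if "x \<in> edges D"
      unfolding other_circuit(1)[OF S C(1) inG(1), symmetric] using D that by simp
    moreover have "D \<in> {C, other_circuit S C y}" if "y \<in> edges D"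
      unfolding other_circuit(1)[OF S C(2) inG(2), symmetric] using D that by simp
    ultimately show "D \<in> {other_circuit S C x, other_circuit S C y}"
      by auto
  qed
  have "card {other_circuit S C x, other_circuit S C y} \<ge> 2"
    using two card_mono[OF _ sub] by simp
  then have ne: "other_circuit S C x \<noteq> other_circuit S C y"
    by (auto simp: insert_absorb)
  then have "{D \<in> S. m \<in> edges D} = {other_circuit S C x, other_circuit S C y}"
  proof (intro card_subset_eq[OF _ sub])
    show "card {D \<in> S. m \<in> edges D} = card {other_circuit S C x, other_circuit S C y}"
      using two ne by simp
  qed simp
  with ne show ?thesis by simp
qed

section \<open>Cycle permutation graphs\<close>

definition prev_pos :: "nat \<Rightarrow> nat \<Rightarrow> nat" where
  "prev_pos k i = (if i = 0 then k - 1 else i - 1)"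

lemma prev_pos_less: "i < k \<Longrightarrow> prev_pos k i < k"
  by (auto simp: prev_pos_def)

lemma next_prev_pos: "i < k \<Longrightarrow> next_pos k (prev_pos k i) = i"
  by (auto simp: prev_pos_def next_pos_def)

lemma prev_next_pos: "i < k \<Longrightarrow> prev_pos k (next_pos k i) = i"
  by (auto simp: prev_pos_def next_pos_def)

lemma next_pos_neq: "2 \<le> k \<Longrightarrow> i < k \<Longrightarrow> next_pos k i \<noteq> i"
  by (auto simp: next_pos_def)

lemma next_next_pos_neq: "3 \<le> k \<Longrightarrow> i < k \<Longrightarrow> next_pos k (next_pos k i) \<noteq> i"
  by (auto simp: next_pos_def)

lemma next_pos_mod: "0 < k \<Longrightarrow> next_pos k (x mod k) = Suc x mod k"
  by (simp add: next_pos_def mod_Suc)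

section \<open>Circuits given by an injective indexing of their vertices\<close>

definition cycle_edge :: "nat \<Rightarrow> (nat \<Rightarrow> 'a) \<Rightarrow> nat \<Rightarrow> 'a set" where
  "cycle_edge k h i = {h i, h (next_pos k i)}"

definition cycle_graph :: "nat \<Rightarrow> (nat \<Rightarrow> 'a) \<Rightarrow> 'a ugraph" where
  "cycle_graph k h = Graph (h ` {..<k}) (cycle_edge k h ` {..<k})"

lemma verts_cycle_graph [simp]: "verts (cycle_graph k h) = h ` {..<k}"
  and edges_cycle_graph [simp]: "edges (cycle_graph k h) = cycle_edge k h ` {..<k}"
  by (simp_all add: cycle_graph_def)

locale cycle =
  fixes k :: nat and h :: "nat \<Rightarrow> 'a"
  assumes k: "3 \<le> k" and inj: "inj_on h {..<k}"
begin

lemma h_eq_iff: "i < k \<Longrightarrow> j < k \<Longrightarrow> h i = h j \<longleftrightarrow> i = j"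
  using inj by (auto simp: inj_on_def)

lemma mem_cycle_edge_iff:
  assumes "i < k" "j < k"
  shows "h i \<in> cycle_edge k h j \<longleftrightarrow> j = i \<or> j = prev_pos k i"
proof -
  have "h i \<in> cycle_edge k h j \<longleftrightarrow> i = j \<or> i = next_pos k j"
    using h_eq_iff[OF assms] h_eq_iff[OF assms(1) next_pos_less[OF assms(2)]] by (simp add: cycle_edge_def)
  then show ?thesis using prev_next_pos[OF assms(2)] next_prev_pos[OF assms(1)] by auto
qed

lemma cycle_edge_inj: "inj_on (cycle_edge k h) {..<k}"
proof (rule inj_onI)
  fix i j assume ij: "i \<in> {..<k}" "j \<in> {..<k}" and eq: "cycle_edge k h i = cycle_edge k h j"
  have "h i \<in> cycle_edge k h j" "h j \<in> cycle_edge k h i"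
    using eq by (auto simp: cycle_edge_def)
  then have *: "j = i \<or> j = prev_pos k i" "i = j \<or> i = prev_pos k j"
    using ij mem_cycle_edge_iff by auto
  show "i = j"
  proof (rule ccontr)
    assume "i \<noteq> j"
    then have "j = prev_pos k i" "i = prev_pos k j"
      using * by auto
    then have "next_pos k j = i" "next_pos k i = j"
      using next_prev_pos[of i k] next_prev_pos[of j k] ij by auto
    \<comment> \<open>This is where \<open>3 \<le> k\<close> enters: on two positions the two edges
      would coincide.\<close>
    then show False using next_next_pos_neq[OF k, of i] ij by simp
  qed
qed

lemma incident:
  assumes "i < k"
  shows "{e \<in> edges (cycle_graph k h). h i \<in> e} = {cycle_edge k h (prev_pos k i), cycle_edge k h i}"
proof -
  have "{e \<in> edges (cycle_graph k h). h i \<in> e} = cycle_edge k h ` {j. j < k \<and> h i \<in> cycle_edge k h j}"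
    by auto
  also have "{j. j < k \<and> h i \<in> cycle_edge k h j} = {prev_pos k i, i}"
    using mem_cycle_edge_iff[OF assms] assms prev_pos_less[OF assms] by auto
  finally show ?thesis by simp
qed

lemma consecutive_edges_neq:
  assumes "i < k"
  shows "cycle_edge k h (prev_pos k i) \<noteq> cycle_edge k h i"
proof
  assume "cycle_edge k h (prev_pos k i) = cycle_edge k h i"
  then have "prev_pos k i = i"
    using cycle_edge_inj assms prev_pos_less[OF assms] by (simp add: inj_on_def)
  then show False using next_prev_pos[OF assms] next_pos_neq[of k i] k assms by simp
qed

lemma simple_cycle_graph: "simple_graph (cycle_graph k h)"
proof -
  have "h i \<noteq> h (next_pos k i)" if "i < k" for i
    using h_eq_iff[OF that next_pos_less[OF that]] next_pos_neq[of k i] k that by simp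
  then have "cycle_edge k h i \<in> {{u, v} |u v. u \<in> h ` {..<k} \<and> v \<in> h ` {..<k} \<and> u \<noteq> v}" if "i < k" for i
    using that next_pos_less[OF that] unfolding cycle_edge_def by blast
  then show ?thesis
    unfolding simple_graph_def by auto
qed

lemma regular_cycle_graph: "regular 2 (cycle_graph k h)"
  unfolding regular_def vdegree_def
proof
  fix v assume "v \<in> verts (cycle_graph k h)"
  then obtain i where "i < k" "v = h i" by auto
  then show "card {e \<in> edges (cycle_graph k h). v \<in> e} = 2"
    using incident[of i] consecutive_edges_neq[of i] by simp
qed

lemma connected_del_verts:
  assumes X: "X \<subseteq> verts (cycle_graph k h)" "card X < 2"
  shows "connected_graph (del_verts (cycle_graph k h) X)" (is "connected_graph ?G")
proof -
  have "finite X" using X(1) finite_subset by auto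
  have "\<exists>j<k. X \<subseteq> {h j}"
  proof (cases "X = {}")
    case True
    then show ?thesis using k by (intro exI[of _ 0]) simp
  next
    case False
    with X(2) \<open>finite X\<close> have "card X = 1" by (metis One_nat_def card_0_eq less_2_cases)
    then obtain x where "X = {x}" by (auto simp: card_1_singleton_iff)
    then show ?thesis using X(1) by auto
  qed
  then obtain j where j: "j < k" "X \<subseteq> {h j}" by blast
  \<comment> \<open>The walk starts just after the only position \<open>j\<close> that may be
    deleted and reaches \<open>j\<close> last, as \<open>r (k - 1)\<close>, so no earlier step meets
    \<open>X\<close>.\<close>
  define r where "r m = (j + 1 + m) mod k" for m
  have r_less: "r m < k" for m using k by (simp add: r_def)
  have r_Suc: "next_pos k (r m) = r (Suc m)" for m
    using k by (simp add: r_def next_pos_mod)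
  have r_neq: "r m \<noteq> j" if "m < k - 1" for m
  proof
    assume "r m = j"
    then have "(j + 1 + m) mod k = (j + 0) mod k" using j by (simp add: r_def)
    then have "(1 + m) mod k = 0 mod k"
      by (simp only: add.assoc nat_mod_eq_iff) auto
    then show False using that by simp
  qed
  have notX: "h (r m) \<notin> X" if "m < k - 1" for m
    using r_neq[OF that] h_eq_iff[OF r_less j(1)] j(2) by blast
  have step: "adjacent ?G (h (r m)) (h (r (Suc m)))" if "h (r m) \<notin> X" "h (r (Suc m)) \<notin> X" for m
    using that r_less[of m] unfolding adjacent_def del_verts_def
    by (auto simp: cycle_edge_def r_Suc)
  have reach: "h (r m) \<notin> X \<longrightarrow> (adjacent ?G)\<^sup>*\<^sup>* (h (r 0)) (h (r m))" if "m < k" for m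
    using that
  proof (induction m)
    case (Suc m)
    then have "h (r m) \<notin> X" using notX[of m] by simp
    then show ?case
      using Suc step[of m] by (auto intro: rtranclp.rtrancl_into_rtrancl)
  qed simp
  show ?thesis
  proof (rule connected_graphI)
    show "h (r 0) \<in> verts ?G"
      using notX[of 0] r_less[of 0] k by (simp add: del_verts_def)
    fix v assume "v \<in> verts ?G"
    then obtain i where i: "i < k" "v = h i" "v \<notin> X" by (auto simp: del_verts_def)
    define m where "m = (if j < i then i - j - 1 else i + k - j - 1)"
    have "r m = i" "m < k" using i(1) j(1) by (auto simp: r_def m_def)
    then show "(adjacent ?G)\<^sup>*\<^sup>* (h (r 0)) v"
      using reach[of m] i by simp
  qed
qed

lemma circuit_cycle_graph: "circuit (cycle_graph k h)"
  using simple_cycle_graph regular_cycle_graph connected_del_verts inj k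
  by (simp add: circuit_def vertex_connected_def card_image)

lemma connected_cycle_graph: "connected_graph (cycle_graph k h)"
  using connected_del_verts[of "{}"] by (simp add: del_verts_def cycle_graph_def)

end

section \<open>The cubic graph of a permutation\<close>

locale permutation_graph =
  fixes k :: nat and p :: "nat \<Rightarrow> nat"
  assumes k5: "5 \<le> k" and perm: "bij_betw p {..<k} {..<k}"
begin

abbreviation "C1 \<equiv> cycle_graph k (\<lambda>i. i)"
abbreviation "C2 \<equiv> cycle_graph k (\<lambda>j. k + j)"
abbreviation "E1 \<equiv> cycle_edge k (\<lambda>i. i)"
abbreviation "E2 \<equiv> cycle_edge k (\<lambda>j. k + j)"

definition spoke :: "nat \<Rightarrow> nat set" where
  "spoke i = {i, k + p i}"

definition G :: "nat ugraph" where
  "G = Graph {..<2 * k} (edges C1 \<union> edges C2 \<union> spoke ` {..<k})"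

sublocale C1: cycle k "\<lambda>i. i"
  using k5 by unfold_locales auto

sublocale C2: cycle k "\<lambda>j. k + j"
  using k5 by unfold_locales auto

lemma p_less: "i < k \<Longrightarrow> p i < k"
  using bij_betwE[OF perm] by simp

lemma p_eq_iff: "i < k \<Longrightarrow> j < k \<Longrightarrow> p i = p j \<longleftrightarrow> i = j"
  using inj_on_eq_iff[OF bij_betw_imp_inj_on[OF perm]] by simp

lemma p_surj:
  assumes "j < k"
  shows "\<exists>i<k. p i = j"
proof -
  have "j \<in> p ` {..<k}" using perm assms by (simp add: bij_betw_def)
  then show ?thesis by auto
qed

lemma edge1_less:
  assumes "e \<in> edges C1" "v \<in> e"
  shows "v < k"
proof -
  obtain i where "i < k" "e = E1 i" using assms(1) by auto
  then show ?thesis using assms(2) next_pos_less[of i k] by (auto simp: cycle_edge_def)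
qed

lemma edge2_ge:
  assumes "e \<in> edges C2" "v \<in> e"
  shows "k \<le> v \<and> v < 2 * k"
proof -
  obtain i where "i < k" "e = E2 i" using assms(1) by auto
  then show ?thesis using assms(2) next_pos_less[of i k] by (auto simp: cycle_edge_def)
qed

lemma spoke_not_edge: "spoke i \<notin> edges C1" "i < k \<Longrightarrow> spoke i \<notin> edges C2"
proof -
  show "spoke i \<notin> edges C1"
  proof
    assume "spoke i \<in> edges C1"
    then have "k + p i < k" by (rule edge1_less) (simp add: spoke_def)
    then show False by simp
  qed
  assume "i < k"
  show "spoke i \<notin> edges C2"
  proof
    assume "spoke i \<in> edges C2"
    then have "k \<le> i \<and> i < 2 * k" by (rule edge2_ge) (simp add: spoke_def)
    then show False using \<open>i < k\<close> by simp
  qed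
qed

lemma spoke_inj: "inj_on spoke {..<k}"
proof (rule inj_onI)
  fix i j assume ij: "i \<in> {..<k}" "j \<in> {..<k}" and "spoke i = spoke j"
  then have "i \<in> spoke j" by (auto simp: spoke_def)
  then show "i = j" using ij by (simp add: spoke_def)
qed

lemma verts_G [simp]: "verts G = {..<2 * k}"
  by (simp add: G_def)

lemma edges_G: "edges G = edges C1 \<union> edges C2 \<union> spoke ` {..<k}"
  by (simp add: G_def)

lemma verts_cycles: "verts C1 = {..<k}" "verts C2 = {k..<2 * k}"
proof -
  show "verts C1 = {..<k}" by simp
  show "verts C2 = {k..<2 * k}"
  proof (intro equalityI subsetI)
    fix x assume "x \<in> {k..<2 * k}"
    then have "x = k + (x - k)" "x - k \<in> {..<k}" by auto
    then show "x \<in> verts C2" unfolding verts_cycle_graph by (rule image_eqI)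
  qed auto
qed

lemma simple_G: "simple_graph G"
proof -
  let ?P = "{{u, v} |u v. u \<in> verts G \<and> v \<in> verts G \<and> u \<noteq> v}"
  have pair: "{u, v} \<in> ?P" if "u < 2 * k" "v < 2 * k" "u \<noteq> v" for u v
    using that unfolding verts_G by blast
  have "spoke i \<in> ?P" if "i < k" for i
    unfolding spoke_def using that p_less[OF that] by (intro pair) auto
  moreover have "E1 i \<in> ?P" if "i < k" for i
    unfolding cycle_edge_def using that next_pos_less[OF that] next_pos_neq[of k i] k5 by (intro pair) auto
  moreover have "E2 i \<in> ?P" if "i < k" for i
    unfolding cycle_edge_def using that next_pos_less[OF that] next_pos_neq[of k i] k5 by (intro pair) auto
  ultimately have "edges G \<subseteq> ?P"
    unfolding edges_G edges_cycle_graph by (intro Un_least image_subsetI) simp_all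
  then show ?thesis
    unfolding simple_graph_def by simp
qed

lemma incident1:
  assumes "i < k"
  shows "{e \<in> edges G. i \<in> e} = {E1 (prev_pos k i), E1 i, spoke i}"
proof -
  have "{e \<in> edges G. i \<in> e} = {e \<in> edges C1. i \<in> e} \<union> {e \<in> edges C2. i \<in> e} \<union> {e \<in> spoke ` {..<k}. i \<in> e}"
    unfolding edges_G by auto
  moreover have "{e \<in> edges C2. i \<in> e} = {}"
    using edge2_ge[of _ i] assms by fastforce
  moreover have "{e \<in> spoke ` {..<k}. i \<in> e} = {spoke i}"
    using assms by (auto simp: spoke_def)
  ultimately show ?thesis using C1.incident[OF assms] by auto
qed

lemma incident2:
  assumes "i < k"
  shows "{e \<in> edges G. k + p i \<in> e} = {E2 (prev_pos k (p i)), E2 (p i), spoke i}"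
proof -
  have "{e \<in> edges G. k + p i \<in> e} =
      {e \<in> edges C1. k + p i \<in> e} \<union> {e \<in> edges C2. k + p i \<in> e} \<union> {e \<in> spoke ` {..<k}. k + p i \<in> e}"
    unfolding edges_G by auto
  moreover have "{e \<in> edges C1. k + p i \<in> e} = {}"
    using edge1_less[of _ "k + p i"] by fastforce
  moreover have "{e \<in> spoke ` {..<k}. k + p i \<in> e} = {spoke i}"
    using assms p_eq_iff[OF assms] by (auto simp: spoke_def)
  ultimately show ?thesis using C2.incident[OF p_less[OF assms]] by auto
qed

lemma spoke_neq: "i < k \<Longrightarrow> j < k \<Longrightarrow> E1 j \<noteq> spoke i" "i < k \<Longrightarrow> j < k \<Longrightarrow> E2 j \<noteq> spoke i"
  using spoke_not_edge[of i] by (auto simp: image_def)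

text \<open>Vertices of the second circuit are named through their partners, so that both cases
  speak of \<open>spoke i\<close>.\<close>

lemma vertexE:
  assumes "v \<in> verts G"
  obtains i where "i < k" "v = i" | i where "i < k" "v = k + p i"
proof (cases "v < k")
  case False
  then have "v - k < k" using assms by simp
  then obtain i where "i < k" "p i = v - k" using p_surj by blast
  then show ?thesis using that(2)[of i] False by simp
qed (use that in blast)

lemma cubic_G: "cubic G"
  unfolding cubic_def regular_def vdegree_def
proof (intro conjI ballI)
  fix v assume "v \<in> verts G"
  then show "card {e \<in> edges G. v \<in> e} = 3"
  proof (cases rule: vertexE)
    case (1 i)
    then show ?thesis
      using C1.consecutive_edges_neq[of i] spoke_neq(1)[of i] prev_pos_less[of i k] incident1[of i] by simp
  next
    case (2 i)
    then show ?thesis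
      using C2.consecutive_edges_neq[of "p i"] p_less[of i] spoke_neq(2)[of i] prev_pos_less[of "p i" k] incident2[of i] by simp
  qed
qed (rule simple_G)

lemma subgraph_cycles: "subgraph C1 G" "subgraph C2 G"
proof -
  have "verts C1 \<subseteq> verts G" "verts C2 \<subseteq> verts G"
    unfolding verts_cycles verts_G by auto
  moreover have "edges C1 \<subseteq> edges G" "edges C2 \<subseteq> edges G"
    unfolding edges_G by blast+
  ultimately show "subgraph C1 G" "subgraph C2 G"
    unfolding subgraph_def using C1.simple_cycle_graph C2.simple_cycle_graph simple_G by simp_all
qed

lemma circuit_cycles: "circuit_of C1 G" "circuit_of C2 G"
  using subgraph_cycles C1.circuit_cycle_graph C2.circuit_cycle_graph by (simp_all add: circuit_of_def)

lemma disjoint_cycles: "vertex_disjoint C1 C2"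
  unfolding vertex_disjoint_def verts_cycles by auto

lemma two_factor_cycles: "two_factor_of_chordless_circuits G C1 C2"
proof -
  have "chordless C1 G"
    unfolding chordless_def verts_cycles edges_G
  proof (intro ballI impI)
    fix e assume e: "e \<in> edges C1 \<union> edges C2 \<union> spoke ` {..<k}" "e \<subseteq> {..<k}"
    have "e \<notin> spoke ` {..<k}" using e(2) by (auto simp: spoke_def)
    moreover have "e \<notin> edges C2" using e(2) by (auto simp: cycle_edge_def)
    ultimately show "e \<in> edges C1" using e(1) by blast
  qed
  moreover have "chordless C2 G"
    unfolding chordless_def verts_cycles edges_G
  proof (intro ballI impI)
    fix e assume e: "e \<in> edges C1 \<union> edges C2 \<union> spoke ` {..<k}" "e \<subseteq> {k..<2 * k}"
    have "e \<notin> spoke ` {..<k}" using e(2) by (auto simp: spoke_def)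
    moreover have "e \<notin> edges C1" using e(2) by (auto simp: cycle_edge_def)
    ultimately show "e \<in> edges C2" using e(1) by blast
  qed
  moreover have "two_factor (graph_union C1 C2) G"
    unfolding two_factor_def regular_def vdegree_def
  proof (intro conjI ballI)
    show "subgraph (graph_union C1 C2) G"
      using simple_graph_union[OF C1.simple_cycle_graph C2.simple_cycle_graph] subgraph_cycles
      by (simp add: subgraph_def graph_union_def)
    show verts: "verts (graph_union C1 C2) = verts G"
      using verts_cycles k5 by (auto simp: graph_union_def simp del: verts_cycle_graph)
    fix v assume "v \<in> verts (graph_union C1 C2)"
    then have "v \<in> verts G" using verts by simp
    then show "card {e \<in> edges (graph_union C1 C2). v \<in> e} = 2"
    proof (cases rule: vertexE)
      case (1 i)
      have "{e \<in> edges (graph_union C1 C2). v \<in> e} = {e \<in> edges C1. i \<in> e}"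
        using edge2_ge[of _ i] 1 by (fastforce simp: graph_union_def simp del: edges_cycle_graph)
      then show ?thesis using C1.incident[of i] C1.consecutive_edges_neq[of i] 1 by simp
    next
      case (2 i)
      have "{e \<in> edges (graph_union C1 C2). v \<in> e} = {e \<in> edges C2. k + p i \<in> e}"
        using edge1_less[of _ "k + p i"] 2 by (fastforce simp: graph_union_def simp del: edges_cycle_graph)
      then show ?thesis
        using C2.incident[of "p i"] C2.consecutive_edges_neq[of "p i"] p_less[of i] 2 by simp
    qed
  qed
  ultimately show ?thesis
    using circuit_cycles disjoint_cycles by (simp add: two_factor_of_chordless_circuits_def)
qed

lemma component_cycles:
  "component C1 (del_edges G (spoke ` {..<k}))" "component C2 (del_edges G (spoke ` {..<k}))"
proof -
  let ?H = "del_edges G (spoke ` {..<k})"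
  have simple: "simple_graph ?H"
    using simple_G by (auto simp: simple_graph_def del_edges_def)
  have "edges C1 \<inter> spoke ` {..<k} = {}" "edges C2 \<inter> spoke ` {..<k} = {}"
    using spoke_not_edge by blast+
  then have edges: "edges ?H = edges C1 \<union> edges C2"
    unfolding del_edges_def edges_G by (simp only: ugraph.sel) blast
  have verts: "verts ?H = verts G" by (simp add: del_edges_def)
  have sub: "subgraph C1 ?H" "subgraph C2 ?H"
    using subgraph_cycles simple unfolding subgraph_def edges verts by simp_all
  show "component C1 ?H"
  proof (rule componentI[OF sub(1) C1.connected_cycle_graph])
    fix e assume e: "e \<in> edges ?H" "e \<inter> verts C1 \<noteq> {}"
    then obtain v where "v \<in> e" "v \<in> verts C1" by blast
    then have "v \<in> e" "v < k" unfolding verts_cycles by simp_all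
    then have "e \<notin> edges C2" using edge2_ge[of e v] by linarith
    then show "e \<in> edges C1" using e(1) unfolding edges by blast
  qed
  show "component C2 ?H"
  proof (rule componentI[OF sub(2) C2.connected_cycle_graph])
    fix e assume e: "e \<in> edges ?H" "e \<inter> verts C2 \<noteq> {}"
    then obtain v where "v \<in> e" "v \<in> verts C2" by blast
    then have "v \<in> e" "k \<le> v" unfolding verts_cycles by simp_all
    then have "e \<notin> edges C1" using edge1_less[of e v] by linarith
    then show "e \<in> edges C2" using e(1) unfolding edges by blast
  qed
qed

text \<open>Some cyclic edge cut must exist for the \<open>LEAST\<close> in
  \<open>cyclic_edge_connectivity\<close> to be attained.\<close>

lemma cyclic_edge_cut_spokes: "cyclic_edge_cut G (spoke ` {..<k})"
proof -
  have "C1 \<noteq> C2"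
  proof
    assume "C1 = C2"
    then have "verts C1 = verts C2" by (rule arg_cong[where f = verts])
    then have "0 \<in> {k..<2 * k}" unfolding verts_cycles using k5 by (metis lessThan_iff less_le_trans zero_less_numeral)
    then show False using k5 by simp
  qed
  moreover have "circuit_of C1 C1" "circuit_of C2 C2"
    unfolding circuit_of_def subgraph_def
    by (intro conjI C1.circuit_cycle_graph C2.circuit_cycle_graph C1.simple_cycle_graph
        C2.simple_cycle_graph subset_refl)+
  moreover have "spoke ` {..<k} \<subseteq> edges G" unfolding edges_G by blast
  ultimately show ?thesis
    unfolding cyclic_edge_cut_def using component_cycles
    by (intro conjI exI[of _ C1] exI[of _ C2])
qed

text \<open>The boundary indices of the two parts of \<open>S\<close> and the mismatched spokes give
  pairwise distinct boundary edges of \<open>S\<close>; for a lower bound this inclusion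
  suffices.\<close>

lemma essentially_5_edge_connected_G:
  assumes "p 0 = 0" "interval_simple k p"
  shows "essentially_5_edge_connected G"
  unfolding essentially_5_edge_connected_def
proof (intro allI impI)
  fix S assume S: "S \<subseteq> verts G" and big: "3 \<le> card S \<and> 3 \<le> card (verts G - S)"
  define A B where "A = {i. i < k \<and> i \<in> S}" and "B = {j. j < k \<and> k + j \<in> S}"
  define M where "M = {i. i < k \<and> (i \<in> A) \<noteq> (p i \<in> B)}"
  have fin: "finite A" "finite B" "finite M" "finite S"
    using finite_subset[OF S] by (simp_all add: A_def B_def M_def)
  have "S = A \<union> (\<lambda>j. k + j) ` B"
  proof (intro equalityI subsetI)
    fix x assume x: "x \<in> S"
    then have "x < 2 * k" using S by auto
    show "x \<in> A \<union> (\<lambda>j. k + j) ` B"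
    proof (cases "x < k")
      case False
      then have "x = k + (x - k)" "x - k \<in> B" using x \<open>x < 2 * k\<close> by (auto simp: B_def)
      then show ?thesis by blast
    qed (use x in \<open>simp add: A_def\<close>)
  qed (auto simp: A_def B_def)
  moreover have "A \<inter> (\<lambda>j. k + j) ` B = {}" by (auto simp: A_def)
  ultimately have card_S: "card S = card A + card B"
    using fin by (simp add: card_Un_disjoint card_image)
  have card_V: "card (verts G - S) = 2 * k - card S"
    using S fin by (simp add: card_Diff_subset)
  have "5 \<le> card (boundary k A) + card (boundary k B) + card M"
    unfolding M_def
  proof (rule permutation_cut_ge5[OF perm assms k5])
    show "A \<subseteq> {..<k}" "B \<subseteq> {..<k}" by (auto simp: A_def B_def)
    show "3 \<le> card A + card B" "card A + card B + 3 \<le> 2 * k"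
      using big card_S card_V by linarith+
  qed
  also have "\<dots> = card (E1 ` boundary k A) + card (E2 ` boundary k B) + card (spoke ` M)"
  proof -
    have "boundary k A \<subseteq> {..<k}" "boundary k B \<subseteq> {..<k}" "M \<subseteq> {..<k}"
      by (auto simp: boundary_def M_def)
    then show ?thesis
      using inj_on_subset[OF C1.cycle_edge_inj] inj_on_subset[OF C2.cycle_edge_inj] inj_on_subset[OF spoke_inj]
      by (simp add: card_image)
  qed
  also have "\<dots> = card (E1 ` boundary k A \<union> E2 ` boundary k B \<union> spoke ` M)"
  proof -
    have "E1 ` boundary k A \<inter> E2 ` boundary k B = {}"
      using next_pos_less[of _ k] by (auto simp: cycle_edge_def boundary_def doubleton_eq_iff)
    moreover have "(E1 ` boundary k A \<union> E2 ` boundary k B) \<inter> spoke ` M = {}"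
      using spoke_neq[THEN not_sym] by (auto simp: boundary_def M_def)
    ultimately show ?thesis using fin by (simp add: card_Un_disjoint)
  qed
  also have "\<dots> \<le> card (edge_boundary G S)"
  proof (rule card_mono)
    show "finite (edge_boundary G S)"
      using finite_edges[OF simple_G] by (simp add: edge_boundary_def)
    have "E1 i \<in> edge_boundary G S" if "i \<in> boundary k A" for i
      using that next_pos_less[of i k] by (auto simp: boundary_def edge_boundary_def edges_G A_def cycle_edge_def)
    moreover have "E2 i \<in> edge_boundary G S" if "i \<in> boundary k B" for i
      using that next_pos_less[of i k] by (auto simp: boundary_def edge_boundary_def edges_G B_def cycle_edge_def)
    moreover have "spoke i \<in> edge_boundary G S" if "i \<in> M" for i
      using that p_less[of i] by (auto simp: M_def edge_boundary_def edges_G A_def B_def spoke_def)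
    ultimately show "E1 ` boundary k A \<union> E2 ` boundary k B \<union> spoke ` M \<subseteq> edge_boundary G S"
      by blast
  qed
  finally show "5 \<le> card (edge_boundary G S)" .
qed

lemma cyclically_5_edge_connected_G:
  assumes "p 0 = 0" "interval_simple k p"
  shows "cyclically_edge_connected 5 G"
proof -
  have "\<exists>F. cyclic_edge_cut G F \<and> card F = cyclic_edge_connectivity G"
    unfolding cyclic_edge_connectivity_def
    by (rule LeastI_ex) (use cyclic_edge_cut_spokes in blast)
  then have "5 \<le> cyclic_edge_connectivity G"
    using cyclic_edge_cut_ge5[OF simple_G essentially_5_edge_connected_G[OF assms]] by metis
  then show ?thesis
    using circuit_cycles disjoint_cycles
    unfolding cyclically_edge_connected_def has_two_disjoint_circuits_def by blast
qed

section \<open>From colourings and double covers to labellings\<close>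

lemma labellingI:
  assumes "\<And>i. i < k \<Longrightarrow> l1 (E1 (prev_pos k i)) \<noteq> l1 (E1 i) \<and> {l1 (E1 (prev_pos k i)), l1 (E1 i)} = T i"
    and "\<And>i. i < k \<Longrightarrow> {l2 (E2 (prev_pos k (p i))), l2 (E2 (p i))} = T i"
  shows "labelling k p (\<lambda>i. l1 (E1 (prev_pos k i))) (\<lambda>j. l2 (E2 (prev_pos k j)))"
  unfolding labelling_def
proof (intro conjI allI impI)
  \<comment> \<open>\<open>E1 i\<close> leaves position \<open>i\<close>, while a labelling is
    indexed by entering edges, hence \<open>prev_pos\<close>. Both 0 and \<open>k\<close> have
    predecessor \<open>k - 1\<close>, which closes the circuit.\<close>
  have "prev_pos k 0 = prev_pos k k" using k5 by (simp add: prev_pos_def)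
  then show "l1 (E1 (prev_pos k 0)) = l1 (E1 (prev_pos k k))" "l2 (E2 (prev_pos k 0)) = l2 (E2 (prev_pos k k))" by simp_all
  have prev_pos_Suc: "prev_pos k (Suc i) = i" for i by (simp add: prev_pos_def)
  fix i assume "i < k"
  then show "l1 (E1 (prev_pos k i)) \<noteq> l1 (E1 (prev_pos k (Suc i)))"
    "{l1 (E1 (prev_pos k i)), l1 (E1 (prev_pos k (Suc i)))} = {l2 (E2 (prev_pos k (p i))), l2 (E2 (prev_pos k (Suc (p i))))}"
    using assms[of i] unfolding prev_pos_Suc by simp_all
qed

lemma third_color:
  fixes a b c :: nat
  assumes "a < 3" "b < 3" "c < 3" "a \<noteq> b" "a \<noteq> c" "b \<noteq> c"
  shows "{a, b} = {0, 1, 2} - {c}"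
proof -
  have "{a, b} = {..<3} - {c}"
  proof (rule card_subset_eq)
    show "{a, b} \<subseteq> {..<3} - {c}" using assms by simp
    show "card {a, b} = card ({..<3} - {c})" using assms by simp
  qed simp
  also have "{..<3} = {0, 1, 2::nat}" by auto
  finally show ?thesis .
qed

lemma labelling_if_edge_colorable:
  assumes "edge_colorable 3 G"
  shows "\<exists>f g :: nat \<Rightarrow> nat. labelling k p f g"
proof -
  obtain c :: "nat set \<Rightarrow> nat" where C: "(\<forall>e\<in>edges G. c e < 3) \<and>
      (\<forall>e\<in>edges G. \<forall>f\<in>edges G. e \<noteq> f \<and> e \<inter> f \<noteq> {} \<longrightarrow> c e \<noteq> c f)"
    using assms unfolding edge_colorable_def by (rule exE)
  have proper: "c e \<noteq> c f" if "e \<in> edges G" "f \<in> edges G" "e \<noteq> f" "v \<in> e" "v \<in> f" for e f v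
  proof -
    have "e \<inter> f \<noteq> {}" using that(4,5) by blast
    then show ?thesis using conjunct2[OF C] that(1-3) by simp
  qed
  have at: "c x \<noteq> c y \<and> {c x, c y} = {0, 1, 2} - {c m}"
    if v: "{e \<in> edges G. v \<in> e} = {x, y, m}" and ne: "x \<noteq> y" "x \<noteq> m" "y \<noteq> m" for v x y m
  proof -
    have "x \<in> {e \<in> edges G. v \<in> e}" "y \<in> {e \<in> edges G. v \<in> e}" "m \<in> {e \<in> edges G. v \<in> e}"
      unfolding v by simp_all
    then have E: "x \<in> edges G" "y \<in> edges G" "m \<in> edges G" and V: "v \<in> x" "v \<in> y" "v \<in> m" by simp_all
    note neq = proper[OF E(1,2) ne(1) V(1,2)] proper[OF E(1,3) ne(2) V(1,3)] proper[OF E(2,3) ne(3) V(2,3)]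
    have "c x < 3" "c y < 3" "c m < 3"
      using conjunct1[OF C] E by simp_all
    then show ?thesis using third_color neq by simp
  qed
  have "labelling k p (\<lambda>i. c (E1 (prev_pos k i))) (\<lambda>j. c (E2 (prev_pos k j)))"
  proof (rule labellingI)
    fix i assume i: "i < k"
    \<comment> \<open>The common pair at both ends of a spoke consists of the two colours that the
      spoke does not have.\<close>
    show "c (E1 (prev_pos k i)) \<noteq> c (E1 i) \<and> {c (E1 (prev_pos k i)), c (E1 i)} = {0, 1, 2} - {c (spoke i)}"
      using incident1[OF i] C1.consecutive_edges_neq[OF i] spoke_neq(1)[OF i prev_pos_less[OF i]] spoke_neq(1)[OF i i]
      by (rule at)
    show "{c (E2 (prev_pos k (p i))), c (E2 (p i))} = {0, 1, 2} - {c (spoke i)}"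
      using at[OF incident2[OF i] C2.consecutive_edges_neq[OF p_less[OF i]]
          spoke_neq(2)[OF i prev_pos_less[OF p_less[OF i]]] spoke_neq(2)[OF i p_less[OF i]]] by (rule conjunct2)
  qed
  then show ?thesis by blast
qed

lemma labelling_if_double_cover:
  assumes S: "circuit_double_cover S G" "C1 \<in> S" "C2 \<in> S"
  shows "\<exists>f g :: nat \<Rightarrow> nat ugraph. labelling k p f g"
proof -
  have "labelling k p (\<lambda>i. other_circuit S C1 (E1 (prev_pos k i))) (\<lambda>j. other_circuit S C2 (E2 (prev_pos k j)))"
  proof (rule labellingI)
    fix i assume i: "i < k"
    show "other_circuit S C1 (E1 (prev_pos k i)) \<noteq> other_circuit S C1 (E1 i) \<and>
        {other_circuit S C1 (E1 (prev_pos k i)), other_circuit S C1 (E1 i)} = {D \<in> S. spoke i \<in> edges D}"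
      using i prev_pos_less[OF i] spoke_not_edge(1)[of i]
      by (intro double_cover_at_vertex[OF S(1,2) incident1[OF i] C1.consecutive_edges_neq[OF i]]) simp_all
    show "{other_circuit S C2 (E2 (prev_pos k (p i))), other_circuit S C2 (E2 (p i))} = {D \<in> S. spoke i \<in> edges D}"
      using i p_less[OF i] prev_pos_less[OF p_less[OF i]] spoke_not_edge(2)[OF i]
      by (intro conjunct2[OF double_cover_at_vertex[OF S(1,3) incident2[OF i] C2.consecutive_edges_neq[OF p_less[OF i]]]]) simp_all
  qed
  then show ?thesis by blast
qed

end

section \<open>The counterexamples\<close>

lemma snark_perm_permutation_graph: "permutation_graph (5 + 12 * n) (snark_perm n)"
  using snark_perm_props(1) by unfold_locales simp_all

theorem corollary2p26:
  fixes n :: nat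
  assumes "n \<ge> 1"
  shows "\<exists>G :: nat ugraph. simple_graph G \<and> card (verts G) = 10 + 24 * n \<and>
    \<not> permutation_snark_conjecture_at G \<and>
    \<not> disjoint_circuits_conjecture_at G \<and>
    \<not> two_factor_conjecture_at G"
proof -
  interpret P: permutation_graph "5 + 12 * n" "snark_perm n"
    by (rule snark_perm_permutation_graph)
  have card: "card (verts P.G) = 10 + 24 * n" by simp
  \<comment> \<open>For positive \<open>n\<close> the order exceeds 10; \<open>n = 0\<close> would
    give the Petersen graph itself.\<close>
  then have not_petersen: "\<not> is_petersen P.G"
    using petersen_card_verts[of P.G] assms by linarith
  note conn = P.cyclically_5_edge_connected_G[OF snark_perm_props(2,4)]
  \<comment> \<open>This refutes both (B), with the two circuits as the disjoint family, and
    (C).\<close>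
  have no_cover: "\<not> (\<exists>S. circuit_double_cover S P.G \<and> P.C1 \<in> S \<and> P.C2 \<in> S)"
  proof
    assume "\<exists>S. circuit_double_cover S P.G \<and> P.C1 \<in> S \<and> P.C2 \<in> S"
    then obtain S where "circuit_double_cover S P.G" "P.C1 \<in> S" "P.C2 \<in> S" by (elim exE conjE)
    from P.labelling_if_double_cover[OF this] show False
      by (elim exE) (erule notE[OF snark_perm_props(5)])
  qed
  have perm: "cycle_permutation_graph P.G"
    unfolding cycle_permutation_graph_def
    by (intro conjI exI) (rule P.cubic_G, rule P.two_factor_cycles)
  have "snark P.G"
    unfolding snark_def
  proof (intro conjI)
    show "cyclically_edge_connected 4 P.G"
      using conn unfolding cyclically_edge_connected_def by linarith
    show "5 \<le> girth P.G"
      by (rule girth_ge5[OF P.cubic_G P.essentially_5_edge_connected_G[OF snark_perm_props(2,4)]])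
        (simp add: card)
    show "\<not> edge_colorable 3 P.G"
    proof
      assume "edge_colorable 3 P.G"
      from P.labelling_if_edge_colorable[OF this] show False
        by (elim exE) (erule notE[OF snark_perm_props(5)])
    qed
  qed (rule P.cubic_G)
  then have A: "\<not> permutation_snark_conjecture_at P.G"
    using conn perm not_petersen by (simp add: permutation_snark_conjecture_at_def)
  have B: "\<not> disjoint_circuits_conjecture_at P.G"
  proof
    assume B: "disjoint_circuits_conjecture_at P.G"
    have "\<forall>C\<in>{P.C1, P.C2}. circuit_of C P.G"
      using P.circuit_cycles by (simp only: ball_simps simp_thms)
    moreover have "pairwise vertex_disjoint {P.C1, P.C2}"
      using P.disjoint_cycles unfolding pairwise_insert vertex_disjoint_def
      by (simp only: pairwise_empty) blast
    ultimately show False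
      using B[unfolded disjoint_circuits_conjecture_at_def, rule_format, of "{P.C1, P.C2}"]
        conn P.cubic_G not_petersen no_cover
      by (metis insert_subset)
  qed
  have C: "\<not> two_factor_conjecture_at P.G"
    unfolding two_factor_conjecture_at_def
    using perm P.two_factor_cycles conn no_cover not_petersen by (metis (no_types, lifting))
  show ?thesis
    using P.simple_G card A B C by (intro exI[of _ P.G] conjI)
qed

end
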